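(* For every $\epsilon>0$ there are constants $c_1=c_1(\epsilon)>0$, $c_2=c_2(\epsilon)>0$ and an integer $n_0=n_0(\epsilon)$ such that for every $n\ge n_0$: (1) there exist $n$ $x$-monotone curves whose intersection graph $G$ has at most $(\frac14+\epsilon)\binom{n}{2}$ edges, but the complement of $G$ does not contain a bi-clique of size $c_1\log n$; (2) for any $n$ $x$-monotone curves whose intersection graph $G$ has at most $(\frac14-\epsilon)\binom{n}{2}$ edges, the complement of $G$ contains a bi-clique of size $c_2 n$.
   Context: A curve is the image of a continuous map $\phi:[0,1]\to\mathbb{R}^2$. A curve is $x$-monotone if every vertical line intersects it in at most one point. The intersection graph of a family of sets has the sets as vertices, two being adjacent iff they have nonempty intersection. A bi-clique in a graph is a pair $(A,B)$ of disjoint vertex sets with $|A|=|B|$ such that every $a\in A$ is adjacent to every $b\in B$; its size is $|A|$. *)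

theory Defs
  imports "HOL-Analysis.Analysis"
begin

definition is_curve :: "(real \<times> real) set \<Rightarrow> bool" where
  "is_curve C \<longleftrightarrow> (\<exists>\<phi> :: real \<Rightarrow> real \<times> real.
      continuous_on {0..1} \<phi> \<and> \<phi> ` {0..1} = C)"

definition x_monotone :: "(real \<times> real) set \<Rightarrow> bool" where
  "x_monotone C \<longleftrightarrow> (\<forall>a. \<forall>p\<in>C. \<forall>q\<in>C. fst p = a \<and> fst q = a \<longrightarrow> p = q)"

definition ig_adj :: "(nat \<Rightarrow> 'a set) \<Rightarrow> nat \<Rightarrow> nat \<Rightarrow> bool" where
  "ig_adj C i j \<longleftrightarrow> i \<noteq> j \<and> C i \<inter> C j \<noteq> {}"

definition ig_edges :: "(nat \<Rightarrow> 'a set) \<Rightarrow> nat \<Rightarrow> (nat \<times> nat) set" where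
  "ig_edges C n = {(i, j). i < j \<and> j < n \<and> ig_adj C i j}"

definition compl_biclique :: "(nat \<Rightarrow> 'a set) \<Rightarrow> nat \<Rightarrow> nat set \<Rightarrow> nat set \<Rightarrow> bool" where
  "compl_biclique C n A B \<longleftrightarrow> A \<subseteq> {..<n} \<and> B \<subseteq> {..<n} \<and> A \<inter> B = {} \<and>
     finite A \<and> card A = card B \<and> (\<forall>a\<in>A. \<forall>b\<in>B. \<not> ig_adj C a b)"

end

theory Submission
  imports Defs
begin

text \<open>
  For the lower bound, two curves that are disjoint from a third one lying between them on a vertical
  line are disjoint from each other on every side on which the third curve reaches far enough. In the
  absence of a linear bi-clique all but few curves cross one vertical line. Among five pairwise disjoint
  curves crossing it, two are always separated in this sense by the others on both sides; but for fixed
  separating curves the pairs they separate form four product sets of disjoint curves, each of which is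
  small. Hence 5-cliques of disjoint curves are rare, and by Turan's theorem at most about 3/4 of the
  pairs are disjoint.

  For the construction, split the curves into four classes, all curves of a class running along the
  same horizontal line. Four classes can have their ends arranged so that any two of them are adjacent in
  some vertical strip, where arbitrary cross pairs can be made to touch; let them touch along a sparse
  random-like pattern that hits every logarithmic rectangle. The least frequent colour of a random
  colouring with many colours is such a pattern.
\<close>

subsection \<open>A colouring without large rectangles missing a colour\<close>

text \<open>Union bound over the \<open>q * (n choose t)^2\<close> triples of a colour and two
  sides: a fixed \<open>t\<close> by \<open>t\<close> rectangle misses a fixed colour in a fraction
  \<open>(1 - 1/q)^(t*t)\<close> of all colourings, and \<open>small\<close> says that these
  fractions sum to less than 1.\<close>

lemma colouring_hitting_all_rectangles:
  fixes n q t :: nat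
  assumes "0 < q" and small: "q * (n choose t)^2 * (q - 1)^(t*t) < q^(t*t)"
  shows "\<exists>H :: nat \<times> nat \<Rightarrow> nat.
    \<forall>A B c. A \<subseteq> {..<n} \<and> B \<subseteq> {..<n} \<and> card A = t \<and> card B = t \<and> c < q
      \<longrightarrow> (\<exists>a\<in>A. \<exists>b\<in>B. H (a, b) = c)"
proof -
  define P where "P = {..<n} \<times> {..<n}"
  define S where "S = PiE P (\<lambda>_. {..<q})"
  define T where "T = {A. A \<subseteq> {..<n} \<and> card A = t}"
  define bad where "bad c A B = PiE P (\<lambda>p. if p \<in> A \<times> B then {..<q} - {c} else {..<q})" for c A B
  have finP: "finite P" and cardP: "card P = n * n" by (auto simp: P_def)
  have cardS: "card S = q^(n*n)"
    using finP cardP by (simp add: S_def card_PiE)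
  have finT: "finite T" and cardT: "card T = n choose t"
    using n_subsets[of "{..<n}" t] by (auto simp: T_def)
  have card_bad: "card (bad c A B) = (q - 1)^(t*t) * q^(n*n - t*t)" and fin_bad: "finite (bad c A B)"
    if "A \<in> T" "B \<in> T" "c < q" for A B c
  proof -
    have AB: "A \<times> B \<subseteq> P" using that by (auto simp: T_def P_def)
    have cAB: "card (A \<times> B) = t * t" using that by (simp add: T_def card_cartesian_product)
    have "card (bad c A B) = (\<Prod>p\<in>P. card (if p \<in> A \<times> B then {..<q} - {c} else {..<q}))"
      unfolding bad_def by (rule card_PiE[OF finP])
    also have "\<dots> = (\<Prod>p\<in>P. if p \<in> A \<times> B then q - 1 else q)"
      using that by (intro prod.cong) auto
    also have "\<dots> = (\<Prod>p\<in>A \<times> B. q - 1) * (\<Prod>p\<in>P - A \<times> B. q)"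
    proof -
      have "P \<inter> {x. x \<in> A \<times> B} = A \<times> B" "P \<inter> - {x. x \<in> A \<times> B} = P - A \<times> B" using AB by auto
      then show ?thesis using prod.If_cases[OF finP, of "\<lambda>p. p \<in> A \<times> B" "\<lambda>_. q - 1" "\<lambda>_. q"] by metis
    qed
    also have "\<dots> = (q - 1)^(t*t) * q^(n*n - t*t)"
      using cAB cardP card_Diff_subset[OF finite_subset[OF AB finP] AB] by simp
    finally show "card (bad c A B) = (q - 1)^(t*t) * q^(n*n - t*t)" .
    show "finite (bad c A B)" unfolding bad_def by (rule finite_PiE[OF finP]) auto
  qed
  have "\<exists>H\<in>S. \<forall>c<q. \<forall>A\<in>T. \<forall>B\<in>T. H \<notin> bad c A B"
  proof (rule ccontr)
    assume "\<not> ?thesis"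
    then have sub: "S \<subseteq> (\<Union>c\<in>{..<q}. \<Union>A\<in>T. \<Union>B\<in>T. bad c A B)" by blast
    have "card S \<le> card (\<Union>c\<in>{..<q}. \<Union>A\<in>T. \<Union>B\<in>T. bad c A B)"
      by (rule card_mono[OF _ sub]) (use fin_bad finT in auto)
    also have "\<dots> \<le> (\<Sum>c\<in>{..<q}. \<Sum>A\<in>T. \<Sum>B\<in>T. card (bad c A B))"
      by (intro order_trans[OF card_UN_le] sum_mono finT) (simp_all add: finT)
    also have "\<dots> = (\<Sum>c\<in>{..<q}. \<Sum>A\<in>T. \<Sum>B\<in>T. (q - 1)^(t*t) * q^(n*n - t*t))"
      by (intro sum.cong) (auto simp: card_bad)
    also have "\<dots> = q * (n choose t)^2 * (q - 1)^(t*t) * q^(n*n - t*t)"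
      by (simp add: cardT power2_eq_square mult_ac)
    finally have le: "q^(n*n) \<le> q * (n choose t)^2 * (q - 1)^(t*t) * q^(n*n - t*t)"
      by (simp add: cardS)
    show False
    \<comment> \<open>The exponent \<open>n*n - t*t\<close> is a truncated subtraction, faithful
      once \<open>t \<le> n\<close>. If \<open>T\<close> is empty there are no bad colourings at
      all, and the bound collapses to 0.\<close>
    proof (cases "T = {}")
      case True
      then have "n choose t = 0" using cardT by simp
      then have "q^(n*n) = 0" using le[unfolded \<open>n choose t = 0\<close>] by simp
      then show False using \<open>0 < q\<close> by simp
    next
      case False
      then obtain A where "A \<in> T" by blast
      then have "t \<le> n" by (auto simp: T_def dest: card_mono[rotated])
      then have "t * t \<le> n * n" by (intro mult_le_mono)
      then have "q^(n*n) = q^(t*t) * q^(n*n - t*t)" by (simp flip: power_add)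
      then show False using le small \<open>0 < q\<close> by simp
    qed
  qed
  then obtain H where H: "H \<in> S" and good: "\<And>c A B. c < q \<Longrightarrow> A \<in> T \<Longrightarrow> B \<in> T \<Longrightarrow> H \<notin> bad c A B"
    by blast
  show ?thesis
  proof (intro exI allI impI)
    fix A B c assume *: "A \<subseteq> {..<n} \<and> B \<subseteq> {..<n} \<and> card A = t \<and> card B = t \<and> c < q"
    show "\<exists>a\<in>A. \<exists>b\<in>B. H (a,b) = c"
    proof (rule ccontr)
      assume "\<not> ?thesis"
      then have "H \<in> bad c A B"
        using H unfolding S_def bad_def by (auto simp: PiE_iff)
      then show False using good[of c A B] * by (simp add: T_def)
    qed
  qed
qed

text \<open>The 3 pays for three factors of size at most \<open>n^t\<close>: the two binomials and
  \<open>q\<close> itself. Their product is below \<open>exp (3 * t * ln n)\<close>, which is beaten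
  by \<open>(1 - 1/q)^(t*t) \<le> exp (- t*t/q)\<close>.\<close>

lemma hitting_threshold:
  fixes n q t :: nat
  assumes n: "2 \<le> n" and q: "2 \<le> q" and t: "3 * real q * ln (real n) \<le> real t"
  shows "q * (n choose t)^2 * (q - 1)^(t*t) < q^(t*t)"
proof -
  \<comment> \<open>The value 1/3 matches the 3 in \<open>t\<close>: it gives
    \<open>q \<le> t\<close>, whence \<open>q < 2^q \<le> n^t\<close>.\<close>
  have ln2: "ln (real n) \<ge> 1/3"
  proof -
    have "ln (real n) \<ge> ln 2" using n by simp
    moreover have "ln (2::real) \<ge> 1/3" using ln_le_minus_one[of "1/2::real"] by (simp add: ln_div)
    ultimately show ?thesis by linarith
  qed
  have "real q \<le> 3 * real q * ln (real n)" using mult_left_mono[OF ln2, of "3 * real q"] by simp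
  then have qt: "q \<le> t" using t by linarith
  have "q < n^t"
  proof -
    have "q < 2^q" by (rule less_exp)
    also have "\<dots> \<le> 2^t" using qt by (simp add: power_increasing)
    also have "\<dots> \<le> n^t" using n by (intro power_mono) auto
    finally show ?thesis .
  qed
  have nct: "n choose t \<le> n^t"
    by (cases "t \<le> n") (auto simp: binomial_le_pow binomial_eq_0)
  have npow: "real n ^ t = exp (real t * ln (real n))" for t
    using n by (simp add: exp_of_nat_mult)
  have one: "(1 - 1 / real q) ^ (t*t) \<le> exp (- (real t * real t / real q))"
  proof -
    have "1 - 1 / real q \<le> exp (- (1 / real q))" using exp_ge_add_one_self[of "- (1 / real q)"] by simp
    then have "(1 - 1 / real q) ^ (t*t) \<le> exp (- (1 / real q)) ^ (t*t)"
      using q by (intro power_mono) auto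
    also have "\<dots> = exp (- (real t * real t / real q))"
      by (simp flip: exp_of_nat_mult)
    finally show ?thesis .
  qed
  have "real (q * (n choose t)^2) * (1 - 1 / real q) ^ (t*t)
      \<le> real (q * (n^t)^2) * exp (- (real t * real t / real q))"
    using nct q by (intro mult_mono one) (auto intro!: power_mono simp del: of_nat_power simp flip: of_nat_power)
  also have "\<dots> < real (n^t * (n^t)^2) * exp (- (real t * real t / real q))"
    using \<open>q < n^t\<close> n by (intro mult_strict_right_mono) (auto simp del: of_nat_power simp flip: of_nat_power)
  also have "real (n^t * (n^t)^2) = exp (3 * real t * ln (real n))"
    using npow[of t] n by (simp add: power2_eq_square npow flip: exp_add)
  also have "exp (3 * real t * ln (real n)) * exp (- (real t * real t / real q))
      = exp (real t * (3 * real q * ln (real n) - real t) / real q)"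
    using q by (simp flip: exp_add add: field_simps)
  also have "\<dots> \<le> 1"
    using t q by (auto simp: divide_le_0_iff mult_le_0_iff)
  finally have lt: "real (q * (n choose t)^2) * (1 - 1 / real q) ^ (t*t) < 1" .
  have "real (q * (n choose t)^2 * (q - 1)^(t*t))
      = (real (q * (n choose t)^2) * (1 - 1 / real q) ^ (t*t)) * real q ^ (t*t)"
    using q by (simp add: of_nat_diff power_divide diff_divide_eq_iff)
  also have "\<dots> < real q ^ (t*t)"
    using lt q by simp
  finally show ?thesis by (simp del: of_nat_mult of_nat_power flip: of_nat_power)
qed

subsection \<open>Realising four classes of curves with prescribed touchings\<close>

definition tent :: "real \<Rightarrow> real" where
  "tent x = max 0 (1 - 2 * \<bar>x\<bar>)"

lemma tent_nonneg: "0 \<le> tent x" and tent_le_1: "tent x \<le> 1" and tent_0: "tent 0 = 1"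
  by (auto simp: tent_def)

lemma tent_pos_iff: "0 < tent x \<longleftrightarrow> \<bar>x\<bar> < 1/2"
  by (auto simp: tent_def)

lemma continuous_tent: "continuous_on S (\<lambda>x. tent (x - a))"
  unfolding tent_def by (intro continuous_intros)

text \<open>Two integers within distance 1/2 of the same point are less than 1 apart. Hence bumps
  placed at different integer slots never interfere.\<close>

lemma tent_int_unique:
  fixes a b :: int and x :: real
  assumes "0 < tent (x - a)" "0 < tent (x - b)"
  shows "a = b"
proof -
  have "\<bar>real_of_int a - b\<bar> < 1" using assms unfolding tent_pos_iff by linarith
  then show ?thesis by linarith
qed

definition graph_over :: "real \<Rightarrow> real \<Rightarrow> (real \<Rightarrow> real) \<Rightarrow> (real \<times> real) set" where
  "graph_over a b f = (\<lambda>x. (x, f x)) ` {a..b}"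

lemma is_curve_graph_over:
  assumes "a \<le> b" "continuous_on {a..b} f"
  shows "is_curve (graph_over a b f)"
  unfolding is_curve_def
proof (intro exI conjI)
  let ?p = "\<lambda>t. a + t * (b - a)"
  have im: "?p ` {0..1} = {a..b}"
  proof (cases "a = b")
    case False
    then have "a < b" using assms by simp
    have "x \<in> ?p ` {0..1}" if "x \<in> {a..b}" for x
      using that \<open>a < b\<close> by (intro image_eqI[where x = "(x - a) / (b - a)"]) (auto simp: field_simps)
    moreover have "?p t \<in> {a..b}" if "t \<in> {0..1}" for t
    proof -
      have "0 \<le> t * (b - a)" "t * (b - a) \<le> 1 * (b - a)"
        using that \<open>a < b\<close> by (intro mult_right_mono mult_nonneg_nonneg; simp)+
      then have "a \<le> ?p t" "?p t \<le> b" by (simp_all add: algebra_simps)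
      then show ?thesis by simp
    qed
    ultimately show ?thesis by blast
  next
    case True
    then show ?thesis by (auto intro: image_eqI[of _ _ 0])
  qed
  show "continuous_on {0..1} (\<lambda>t. (?p t, f (?p t)))"
    by (intro continuous_intros continuous_on_compose2[OF assms(2)]) (use im in auto)
  show "(\<lambda>t. (?p t, f (?p t))) ` {0..1} = graph_over a b f"
    unfolding graph_over_def im[symmetric] image_image ..
qed

lemma x_monotone_graph_over: "x_monotone (graph_over a b f)"
  by (auto simp: x_monotone_def graph_over_def)

lemma graph_over_meet_iff:
  "graph_over a b f \<inter> graph_over c d g \<noteq> {} \<longleftrightarrow> (\<exists>x. a \<le> x \<and> x \<le> b \<and> c \<le> x \<and> x \<le> d \<and> f x = g x)"
  unfolding graph_over_def by fastforce

section \<open>Layout of the strips and of the slots inside them\<close>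

text \<open>
  A curve of residue class \<open>a\<close> modulo 4 runs at height \<open>a\<close> over a range of vertical strips
  of width \<open>n * n + 1\<close>: classes 0 and 3 over the strips \<open>-1, 0, 1, 2\<close>, class 1 over
  \<open>-1, 0\<close> and class 2 over \<open>0, 1\<close>. The strip \<open>slot_region a b\<close> is one in
  which both classes are present but every class lying strictly between them is absent, so a pair of
  curves can be made to touch there at half height without meeting any third curve. Each pair gets
  its own integer abscissa \<open>slot n i j\<close> for this.
\<close>

definition slot_region :: "nat \<Rightarrow> nat \<Rightarrow> int" where
  "slot_region a b = (if (a, b) \<in> {(0, 2), (2, 0)} then 1 else if (a, b) \<in> {(0, 3), (3, 0)} then 2
     else if (a, b) \<in> {(1, 3), (3, 1)} then -1 else 0)"

definition left_region :: "nat \<Rightarrow> int" where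
  "left_region a = (if a = 2 then 0 else -1)"

text \<open>The end is exclusive: the last strip of class \<open>a\<close> has index
  \<open>right_region a - 1\<close>.\<close>

definition right_region :: "nat \<Rightarrow> int" where
  "right_region a = (if a = 1 then 1 else if a = 2 then 2 else 3)"

lemma slot_region_commute: "slot_region a b = slot_region b a"
  by (auto simp: slot_region_def)

lemma nat_less_4: "(a::nat) < 4 \<Longrightarrow> a = 0 \<or> a = 1 \<or> a = 2 \<or> a = 3"
  by linarith

lemma slot_region_within:
  assumes "a < 4" "b < 4" "a \<noteq> b"
  shows "left_region a \<le> slot_region a b" "slot_region a b + 1 \<le> right_region a"
  using nat_less_4[OF assms(1)] nat_less_4[OF assms(2)] assms(3)
  by (elim disjE; simp add: slot_region_def left_region_def right_region_def)+

text \<open>This finite check is what makes four classes work: a curve leaving height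
  \<open>a\<close> towards height \<open>b\<close> could only run into classes in between, and those
  do not extend over the strip used.\<close>

lemma slot_region_avoids_between:
  assumes "a < 4" "b < 4" "a < c \<and> c < b \<or> b < c \<and> c < a"
  shows "right_region c \<le> slot_region a b \<or> slot_region a b + 1 \<le> left_region c"
proof -
  have "c < 4" using assms by auto
  then show ?thesis
    using nat_less_4[OF assms(1)] nat_less_4[OF assms(2)] nat_less_4[of c] assms(3)
    by (elim disjE; simp add: slot_region_def left_region_def right_region_def)
qed

text \<open>The offset writes the unordered pair in base \<open>n\<close>. It lies between 1 and
  \<open>n * n\<close>, so in a strip of width \<open>n * n + 1\<close> every slot stays at distance
  at least 1 from both ends, and its bump fits inside the strip.\<close>

definition slot :: "nat \<Rightarrow> nat \<Rightarrow> nat \<Rightarrow> int" where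
  "slot n i j = slot_region (i mod 4) (j mod 4) * int (n * n + 1) + int (min i j * n + max i j + 1)"

lemma slot_commute: "slot n i j = slot n j i"
  by (simp add: slot_def slot_region_commute min.commute max.commute)

lemma slot_offset:
  fixes i j n :: nat
  assumes "i < n" "j < n"
  shows "min i j * n + max i j + 1 \<le> n * n"
proof -
  have "Suc (min i j) * n \<le> n * n" using assms by (intro mult_le_mono) auto
  then show ?thesis using assms by auto
qed

lemma slot_bounds:
  assumes "i < n" "j < n"
  shows "slot_region (i mod 4) (j mod 4) * int (n * n + 1) + 1 \<le> slot n i j"
    and "slot n i j + 1 \<le> (slot_region (i mod 4) (j mod 4) + 1) * int (n * n + 1)"
proof -
  have "int (min i j * n + max i j + 1) \<le> int (n * n)"
    using slot_offset[OF assms] by (simp only: of_nat_le_iff)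
  then show "slot_region (i mod 4) (j mod 4) * int (n * n + 1) + 1 \<le> slot n i j"
    "slot n i j + 1 \<le> (slot_region (i mod 4) (j mod 4) + 1) * int (n * n + 1)"
    unfolding slot_def by (simp_all add: algebra_simps)
qed

lemma slot_mod:
  assumes "i < n" "j < n"
  shows "slot n i j mod int (n * n + 1) = int (min i j * n + max i j + 1)"
proof -
  have "int (min i j * n + max i j + 1) < int (n * n + 1)"
    using slot_offset[OF assms] by (simp only: of_nat_less_iff)
  then show ?thesis unfolding slot_def by (simp only: mod_mult_self3 mod_pos_pos_trivial of_nat_0_le_iff)
qed

text \<open>The abscissa 0 is reserved as the place where all curves of one class meet at their base
  height, so no bump may be there.\<close>

lemma slot_nonzero:
  assumes "i < n" "j < n"
  shows "slot n i j \<noteq> 0"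
proof
  assume "slot n i j = 0"
  then have "int (min i j * n + max i j + 1) = 0" using slot_mod[OF assms] by (simp only: mod_0)
  then show False by (simp only: of_nat_eq_0_iff add_is_0 one_neq_zero simp_thms)
qed

text \<open>Reduction modulo the strip width recovers the offset, and division by \<open>n\<close>
  with remainder then recovers the smaller and the larger index.\<close>

lemma slot_inj:
  assumes "i < n" "j < n" "k < n" "l < n" "slot n i j = slot n k l"
  shows "{i, j} = {k, l}"
proof -
  have "int (min i j * n + max i j + 1) = int (min k l * n + max k l + 1)"
    using slot_mod[OF assms(1,2)] slot_mod[OF assms(3,4)] assms(5) by (simp only:)
  then have eq: "min i j * n + max i j = min k l * n + max k l"
    by (simp only: of_nat_eq_iff add_right_cancel)
  have "(min i j * n + max i j) div n = min i j" "(min k l * n + max k l) div n = min k l"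
    using assms(1-4) by (simp_all add: div_mult_self3)
  then have "min i j = min k l" using eq by simp
  then have "max i j = max k l" using eq by simp
  with \<open>min i j = min k l\<close> show ?thesis
    by (auto simp: min_def max_def split: if_splits)
qed

section \<open>Curves realising a prescribed symmetric touching relation between classes\<close>

locale touching_pattern =
  fixes n :: nat and R :: "nat \<Rightarrow> nat \<Rightarrow> bool"
  assumes R_sym: "R i j \<Longrightarrow> R j i"
begin

definition touches :: "nat \<Rightarrow> nat \<Rightarrow> bool" where
  "touches i j \<longleftrightarrow> R i j \<and> i mod 4 \<noteq> j mod 4"

text \<open>Each summand leads curve \<open>i\<close> at its peak to the midpoint of the two base
  heights; the partner \<open>j\<close> arrives at the same midpoint from the other side.\<close>

definition height :: "nat \<Rightarrow> real \<Rightarrow> real" where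
  "height i x = real (i mod 4) + (\<Sum>j\<in>{j. j < n \<and> touches i j}.
     (real (j mod 4) - real (i mod 4)) / 2 * tent (x - slot n i j))"

definition curve :: "nat \<Rightarrow> (real \<times> real) set" where
  "curve i = graph_over (left_region (i mod 4) * int (n * n + 1))
     (right_region (i mod 4) * int (n * n + 1)) (height i)"

lemma height_at_tent:
  fixes x :: real
  assumes "i < n" "j < n" "touches i j" "0 < tent (x - slot n i j)"
  shows "height i x = real (i mod 4) + (real (j mod 4) - real (i mod 4)) / 2 * tent (x - slot n i j)"
proof -
  let ?J = "{j. j < n \<and> touches i j}"
  have "tent (x - slot n i k) = 0" if "k \<in> ?J - {j}" for k
  proof (rule ccontr)
    assume "\<not> ?thesis"
    then have "0 < tent (x - slot n i k)" using tent_nonneg[of "x - slot n i k"] by simp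
    then have "slot n i k = slot n i j" using tent_int_unique assms(4) by blast
    then have "{i, k} = {i, j}" using slot_inj[of i n k i j] that assms(1,2) by auto
    then show False using that by (auto simp: doubleton_eq_iff)
  qed
  then have "(\<Sum>k\<in>?J. (real (k mod 4) - real (i mod 4)) / 2 * tent (x - slot n i k))
      = (\<Sum>k\<in>{j}. (real (k mod 4) - real (i mod 4)) / 2 * tent (x - slot n i k))"
    using assms by (intro sum.mono_neutral_right) auto
  then show ?thesis by (simp add: height_def)
qed

lemma height_base:
  fixes x :: real
  assumes "\<And>j. j < n \<Longrightarrow> touches i j \<Longrightarrow> \<not> 0 < tent (x - slot n i j)"
  shows "height i x = real (i mod 4)"
proof -
  have "tent (x - slot n i j) = 0" if "j < n" "touches i j" for j
    using assms[OF that] tent_nonneg[of "x - slot n i j"] by simp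
  then show ?thesis by (simp add: height_def)
qed

lemma continuous_height: "continuous_on S (height i)"
  unfolding height_def by (intro continuous_intros continuous_tent)

lemma is_curve_curve: "is_curve (curve i)"
  unfolding curve_def
  by (intro is_curve_graph_over continuous_height of_int_le_iff[THEN iffD2] mult_right_mono)
    (auto simp: left_region_def right_region_def)

text \<open>On a bump from class \<open>a\<close> towards class \<open>b\<close> the height is
  strictly between \<open>a\<close> and \<open>b\<close>. If it equals an integer \<open>c\<close>,
  then class \<open>c\<close> lies between the two and does not extend over this strip. So a curve
  on a bump never meets another one at base height.\<close>

lemma tent_not_at_between:
  fixes x :: real
  assumes "i < n" "k < n" "touches i k" "0 < tent (x - slot n i k)"
    and dom: "left_region (j mod 4) * int (n * n + 1) \<le> x" "x \<le> right_region (j mod 4) * int (n * n + 1)"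
  shows "height i x \<noteq> real (j mod 4)"
proof
  assume "height i x = real (j mod 4)"
  define a b c where "a = i mod 4" and "b = k mod 4" and "c = j mod 4"
  define s where "s = tent (x - slot n i k)"
  have less: "a < 4" "b < 4" by (simp_all add: a_def b_def)
  have "a \<noteq> b" using assms(3) by (simp add: touches_def a_def b_def)
  have eq: "real a + (real b - real a) / 2 * s = real c"
    using height_at_tent[OF assms(1-4)] \<open>height i x = _\<close> by (simp add: a_def b_def c_def s_def)
  have s: "0 < s" "s \<le> 1" using assms(4) tent_le_1 by (auto simp: s_def)
  have "a < c \<and> c < b \<or> b < c \<and> c < a"
  proof (cases "a < b")
    case True
    then have d: "real b - real a > 0" by simp
    then have "(real b - real a) * s > 0" "(real b - real a) * s \<le> real b - real a"
      using s by (auto intro: mult_left_le)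
    then have "real a < real c" "real c < real b" using eq d by (auto simp: field_simps)
    then show ?thesis by simp
  next
    case False
    then have d: "real a - real b > 0" using \<open>a \<noteq> b\<close> by simp
    then have "(real a - real b) * s > 0" "(real a - real b) * s \<le> real a - real b"
      using s by (auto intro: mult_left_le)
    then have "real c < real a" "real b < real c" using eq d by (auto simp: field_simps)
    then show ?thesis by simp
  qed
  then have *: "right_region c \<le> slot_region a b \<or> slot_region a b + 1 \<le> left_region c"
    using slot_region_avoids_between less by blast
  define M where "M = int (n * n + 1)"
  have M: "0 \<le> M" by (simp add: M_def)
  \<comment> \<open>Slots keep distance 1 from the ends of their strip, more than the bump radius
    1/2 in \<open>near\<close>, so \<open>x\<close> is strictly inside a strip where class
    \<open>c\<close> is absent.\<close>
  have sl: "slot_region a b * M + 1 \<le> slot n i k" "slot n i k + 1 \<le> (slot_region a b + 1) * M"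
    using slot_bounds[OF assms(1,2)] by (simp_all only: a_def b_def M_def)
  have near: "\<bar>x - slot n i k\<bar> < 1/2" using assms(4) by (simp add: tent_pos_iff)
  from * show False
  proof
    assume "right_region c \<le> slot_region a b"
    then have "right_region c * M \<le> slot_region a b * M" using M by (rule mult_right_mono)
    then have "real_of_int (right_region c * M) + 1 \<le> slot n i k" using sl(1) by linarith
    then show False using dom(2) near unfolding c_def M_def by linarith
  next
    assume "slot_region a b + 1 \<le> left_region c"
    then have "(slot_region a b + 1) * M \<le> left_region c * M" using M by (rule mult_right_mono)
    then have "real_of_int (left_region c * M) \<ge> slot n i k + 1" using sl(2) by linarith
    then show False using dom(1) near unfolding c_def M_def by linarith
  qed
qed

lemma slot_in_domain:
  assumes "i < n" "j < n" "i mod 4 \<noteq> j mod 4"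
  shows "left_region (i mod 4) * int (n * n + 1) \<le> slot n i j"
    and "slot n i j \<le> right_region (i mod 4) * int (n * n + 1)"
proof -
  define M where "M = int (n * n + 1)"
  have M: "0 \<le> M" by (simp add: M_def)
  have w: "left_region (i mod 4) \<le> slot_region (i mod 4) (j mod 4)"
    "slot_region (i mod 4) (j mod 4) + 1 \<le> right_region (i mod 4)"
    using slot_region_within[of "i mod 4" "j mod 4"] assms(3) by auto
  show "left_region (i mod 4) * int (n * n + 1) \<le> slot n i j"
    using mult_right_mono[OF w(1) M] slot_bounds(1)[OF assms(1,2)] unfolding M_def by linarith
  show "slot n i j \<le> right_region (i mod 4) * int (n * n + 1)"
    using mult_right_mono[OF w(2) M] slot_bounds(2)[OF assms(1,2)] unfolding M_def by linarith
qed

text \<open>At a common point either both curves are at base height, so their classes agree, or both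
  are on a bump; in the latter case the slots coincide, and the curves are each other's partner.
  Conversely, equal classes meet at abscissa 0 and related pairs of different classes at their
  slot.\<close>

lemma curves_meet_iff:
  assumes "i < n" "j < n" "i \<noteq> j"
  shows "curve i \<inter> curve j \<noteq> {} \<longleftrightarrow> i mod 4 = j mod 4 \<or> R i j"
proof
  assume "curve i \<inter> curve j \<noteq> {}"
  then obtain x :: real where
    dom: "left_region (i mod 4) * int (n * n + 1) \<le> x" "x \<le> right_region (i mod 4) * int (n * n + 1)"
      "left_region (j mod 4) * int (n * n + 1) \<le> x" "x \<le> right_region (j mod 4) * int (n * n + 1)"
    and eq: "height i x = height j x"
    unfolding curve_def graph_over_meet_iff by blast
  show "i mod 4 = j mod 4 \<or> R i j"
  proof (cases "\<exists>k<n. touches i k \<and> 0 < tent (x - slot n i k)")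
    case True
    then obtain k where k: "k < n" "touches i k" "0 < tent (x - slot n i k)" by blast
    have "height j x \<noteq> real (j mod 4)"
      using tent_not_at_between[OF assms(1) k dom(3,4)] eq by simp
    then obtain l where l: "l < n" "touches j l" "0 < tent (x - slot n j l)"
      using height_base[of j x] by blast
    have "slot n i k = slot n j l" using tent_int_unique[OF k(3) l(3)] .
    then have "{i, k} = {j, l}" using slot_inj[OF assms(1) k(1) assms(2) l(1)] by simp
    then have "k = j" using assms(3) by (auto simp: doubleton_eq_iff)
    then show ?thesis using k(2) by (simp add: touches_def)
  next
    case False
    then have hi: "height i x = real (i mod 4)" using height_base[of i x] by blast
    show ?thesis
    proof (cases "\<exists>k<n. touches j k \<and> 0 < tent (x - slot n j k)")
      case True
      then obtain k where k: "k < n" "touches j k" "0 < tent (x - slot n j k)" by blast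
      show ?thesis
        using tent_not_at_between[OF assms(2) k dom(1,2)] eq hi by simp
    next
      case False
      then have "height j x = real (j mod 4)" using height_base[of j x] by blast
      then show ?thesis using eq hi by simp
    qed
  qed
next
  assume *: "i mod 4 = j mod 4 \<or> R i j"
  show "curve i \<inter> curve j \<noteq> {}"
  proof (cases "i mod 4 = j mod 4")
    case True
    have h0: "height k 0 = real (k mod 4)" if "k < n" for k
    proof (rule height_base)
      fix l assume "l < n"
      then have "\<bar>slot n k l\<bar> \<ge> 1" using slot_nonzero[OF that, of l] by linarith
      then have "\<bar>real_of_int (slot n k l)\<bar> \<ge> 1" by linarith
      then show "\<not> 0 < tent ((0::real) - slot n k l)" by (simp add: tent_pos_iff)
    qed
    have d0: "left_region a * int (n * n + 1) \<le> 0" "0 \<le> right_region a * int (n * n + 1)" for a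
      by (intro mult_nonpos_nonneg mult_nonneg_nonneg; simp add: left_region_def right_region_def)+
    have "height i 0 = height j 0" using h0 True assms by simp
    moreover have "real_of_int (left_region a * int (n * n + 1)) \<le> 0"
      "0 \<le> real_of_int (right_region a * int (n * n + 1))" for a
      using d0[of a] by linarith+
    ultimately show ?thesis
      unfolding curve_def graph_over_meet_iff by blast
  next
    case False
    with * have t: "touches i j" "touches j i" by (auto simp: touches_def R_sym)
    let ?x = "real_of_int (slot n i j)"
    have "height i ?x = height j ?x"
      using height_at_tent[OF assms(1,2) t(1), of ?x] height_at_tent[OF assms(2,1) t(2), of ?x]
      by (simp add: slot_commute[of n j i] tent_0 field_simps)
    moreover have "left_region (i mod 4) * int (n * n + 1) \<le> ?x" "?x \<le> right_region (i mod 4) * int (n * n + 1)"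
      "left_region (j mod 4) * int (n * n + 1) \<le> ?x" "?x \<le> right_region (j mod 4) * int (n * n + 1)"
      using slot_in_domain[OF assms(1,2) False] slot_in_domain[OF assms(2,1)] False
      by (simp_all only: of_int_le_iff slot_commute[of n j i])
    ultimately show ?thesis
      unfolding curve_def graph_over_meet_iff by blast
  qed
qed

end

subsection \<open>Sparse families without logarithmic bi-cliques\<close>

lemma card_ordered_pairs:
  "card {(i, j). i < j \<and> j < n \<and> Q i j} = (\<Sum>j<n. card {i. i < (j::nat) \<and> Q i j})"
proof -
  have "{(i, j). i < j \<and> j < n \<and> Q i j} = prod.swap ` (SIGMA j:{..<n}. {i. i < j \<and> Q i j})"
    by force
  then show ?thesis by (simp add: card_image card_SigmaI)
qed

lemma sum_lessThan_choose_two: "(\<Sum>j<n. j) = n choose 2"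
  by (induction n) (auto simp: numeral_2_eq_2)

lemma finite_ordered_pairs: "finite {(i, j). i < j \<and> j < n \<and> Q i (j::nat)}"
  by (rule finite_subset[of _ "{..<n} \<times> {..<n}"]) auto

text \<open>Division by 4 is injective on a residue class. Summed over \<open>j\<close>, this bounds
  the share of pairs within one class by 1/4 without an error term.\<close>

lemma card_same_residue: "4 * card {i. i < j \<and> i mod 4 = j mod (4::nat)} \<le> j"
proof -
  have "card {i. i < j \<and> i mod 4 = j mod 4} \<le> card {..<j div 4}"
  proof (rule card_inj_on_le[where f = "\<lambda>i. i div 4"])
    show "inj_on (\<lambda>i. i div 4) {i. i < j \<and> i mod 4 = j mod 4}"
      by (rule inj_onI) (metis (mono_tags, lifting) div_mod_decomp mem_Collect_eq)
    show "(\<lambda>i. i div 4) ` {i. i < j \<and> i mod 4 = j mod 4} \<subseteq> {..<j div 4}"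
    proof clarsimp
      fix i assume *: "i < j" "i mod 4 = j mod 4"
      have "i = i div 4 * 4 + i mod 4" "j = j div 4 * 4 + j mod 4" by simp_all
      then show "i div 4 < j div 4" using * by linarith
    qed
  qed auto
  then show ?thesis by simp
qed

lemma residue_class_pigeonhole:
  fixes A :: "nat set"
  assumes "finite A"
  shows "\<exists>r. card A \<le> 4 * card {a \<in> A. a mod 4 = r}"
proof (rule ccontr)
  assume "\<not> ?thesis"
  then have lt: "4 * card {a \<in> A. a mod 4 = r} < card A" for r
    by (simp add: not_le)
  have "4 * card A = 4 * card (\<Union>r\<in>{..<4}. {a \<in> A. a mod 4 = r})"
    by (rule arg_cong[where f = "\<lambda>X. 4 * card X"]) auto
  also have "\<dots> \<le> 4 * (\<Sum>r<4. card {a \<in> A. a mod 4 = r})"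
    by (intro mult_le_mono2 card_UN_le) simp
  also have "\<dots> < (\<Sum>r<(4::nat). card A)"
    unfolding sum_distrib_left by (rule sum_strict_mono) (use lt in \<open>auto simp: lessThan_empty_iff\<close>)
  finally show False by simp
qed

lemma sparse_curves_without_log_biclique:
  fixes \<epsilon> :: real
  assumes "\<epsilon> > 0"
  shows "\<exists>c>0. \<forall>n\<ge>2. \<exists>C :: nat \<Rightarrow> (real \<times> real) set.
        (\<forall>i<n. is_curve (C i) \<and> x_monotone (C i)) \<and>
        real (card (ig_edges C n)) \<le> (1/4 + \<epsilon>) * real (n choose 2) \<and>
        \<not> (\<exists>A B. compl_biclique C n A B \<and> real (card A) \<ge> c * ln (real n))"
proof -
  \<comment> \<open>At least \<open>1 / \<epsilon>\<close> colours, so that the least frequent one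
    takes at most an \<open>\<epsilon>\<close> share of the pairs; the 2 ensures
    \<open>2 \<le> q\<close>, as the threshold lemma demands.\<close>
  define q where "q = nat \<lceil>1 / \<epsilon>\<rceil> + 2"
  have q2: "2 \<le> q" by (simp add: q_def)
  have "1 / \<epsilon> \<le> real q" unfolding q_def by linarith
  then have qe: "1 \<le> \<epsilon> * real q" using assms by (simp add: field_simps)
  show ?thesis
  \<comment> \<open>12 is 4 times 3: passing to one residue class costs a factor 4, and
    \<open>3 * q * ln n\<close> is the side length from which every rectangle contains every
    colour.\<close>
  proof (rule exI[of _ "12 * real q"], intro conjI allI impI)
    show "12 * real q > 0" using q2 by simp
    fix n :: nat assume n: "2 \<le> n"
    define t where "t = nat \<lceil>3 * real q * ln (real n)\<rceil>"
    have ln_pos: "ln (real n) > 0" using n by simp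
    have t: "3 * real q * ln (real n) \<le> real t" unfolding t_def by linarith
    then have t_pos: "t > 0" using ln_pos q2 by (cases t) (auto simp: mult_le_0_iff)
    have q_pos: "0 < q" using q2 by simp
    obtain H :: "nat \<times> nat \<Rightarrow> nat"
      where hit: "\<forall>A B c. A \<subseteq> {..<n} \<and> B \<subseteq> {..<n} \<and> card A = t \<and> card B = t \<and> c < q
        \<longrightarrow> (\<exists>a\<in>A. \<exists>b\<in>B. H (a, b) = c)"
      using colouring_hitting_all_rectangles[OF q_pos hitting_threshold[OF n q2 t]] by (elim exE)
    \<comment> \<open>\<open>H\<close> need not be symmetric. Reading its arguments in order of
      increasing residue makes \<open>R c\<close> symmetric and ignores pairs within a
      class.\<close>
    define R where "R c i j \<longleftrightarrow> (i mod 4 < j mod 4 \<and> H (i, j) = c) \<or> (j mod 4 < i mod 4 \<and> H (j, i) = c)"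
      for c i j
    define cross where "cross c = {(i, j). i < j \<and> j < n \<and> R c i j}" for c
    have fin_cross: "finite (cross c)" for c unfolding cross_def by (rule finite_ordered_pairs)
    have cross_disj: "cross c \<inter> cross d = {}" if "c \<noteq> d" for c d
      using that unfolding cross_def R_def by auto
    have card_all: "card {(i, j). i < j \<and> j < n} = n choose 2"
      using card_ordered_pairs[of n "\<lambda>_ _. True"] by (simp add: sum_lessThan_choose_two)
    have "\<exists>c<q. q * card (cross c) \<le> n choose 2"
    proof (rule ccontr)
      assume "\<not> ?thesis"
      then have "(\<Sum>c<q. n choose 2) < (\<Sum>c<q. q * card (cross c))"
        using q_pos by (intro sum_strict_mono) auto
      also have "\<dots> = q * card (\<Union>c\<in>{..<q}. cross c)"
        unfolding sum_distrib_left[symmetric]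
        by (subst card_UN_disjoint) (use fin_cross cross_disj in auto)
      also have "\<dots> \<le> q * card {(i, j). i < j \<and> j < n}"
        using finite_ordered_pairs[of n "\<lambda>_ _. True"]
        by (intro mult_le_mono card_mono) (auto simp: cross_def)
      finally show False by (simp add: card_all)
    qed
    then obtain c where c: "c < q" "q * card (cross c) \<le> n choose 2" by blast
    interpret touching_pattern n "R c"
      by unfold_locales (auto simp: R_def)
    have edges: "ig_edges curve n = {(i, j). i < j \<and> j < n \<and> i mod 4 = j mod 4} \<union> cross c"
    proof -
      have "ig_adj curve i j \<longleftrightarrow> i mod 4 = j mod 4 \<or> R c i j" if "i < j" "j < n" for i j
        using curves_meet_iff[of i j] that by (simp add: ig_adj_def)
      then show ?thesis unfolding ig_edges_def cross_def by auto
    qed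
    have same: "4 * card {(i, j). i < j \<and> j < n \<and> i mod 4 = j mod 4} \<le> n choose 2"
      unfolding card_ordered_pairs sum_distrib_left sum_lessThan_choose_two[symmetric]
      by (rule sum_mono) (rule card_same_residue)
    show "\<exists>C :: nat \<Rightarrow> (real \<times> real) set.
        (\<forall>i<n. is_curve (C i) \<and> x_monotone (C i)) \<and>
        real (card (ig_edges C n)) \<le> (1/4 + \<epsilon>) * real (n choose 2) \<and>
        \<not> (\<exists>A B. compl_biclique C n A B \<and> real (card A) \<ge> 12 * real q * ln (real n))"
    proof (intro exI conjI allI impI)
      show "is_curve (curve i)" for i by (rule is_curve_curve)
      show "x_monotone (curve i)" for i unfolding curve_def by (rule x_monotone_graph_over)
      have "real (card (ig_edges curve n))
          \<le> real (card {(i, j). i < j \<and> j < n \<and> i mod 4 = j mod 4}) + real (card (cross c))"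
        unfolding edges of_nat_add[symmetric] of_nat_le_iff by (rule card_Un_le)
      moreover have "4 * real (card {(i, j). i < j \<and> j < n \<and> i mod 4 = j mod 4}) \<le> real (n choose 2)"
        using of_nat_mono[OF same, where 'a = real] by simp
      moreover have "real (card (cross c)) \<le> \<epsilon> * real (n choose 2)"
      proof -
        have "real (card (cross c)) \<le> (\<epsilon> * real q) * real (card (cross c))"
          using mult_right_mono[OF qe, of "real (card (cross c))"] by simp
        also have "\<dots> = \<epsilon> * real (q * card (cross c))" by simp
        also have "\<dots> \<le> \<epsilon> * real (n choose 2)"
          using c(2) assms by (intro mult_left_mono) (simp_all only: of_nat_le_iff less_imp_le)
        finally show ?thesis .
      qed
      ultimately show "real (card (ig_edges curve n)) \<le> (1/4 + \<epsilon>) * real (n choose 2)"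
        unfolding distrib_right by linarith
      show "\<not> (\<exists>A B. compl_biclique curve n A B \<and> real (card A) \<ge> 12 * real q * ln (real n))"
      proof clarify
        fix A B assume bi: "compl_biclique curve n A B" and big: "real (card A) \<ge> 12 * real q * ln (real n)"
        have sub: "A \<subseteq> {..<n}" "B \<subseteq> {..<n}" and disj: "A \<inter> B = {}" and cardB: "card B = card A"
          and nonadj: "\<And>a b. a \<in> A \<Longrightarrow> b \<in> B \<Longrightarrow> \<not> ig_adj curve a b"
          using bi by (auto simp: compl_biclique_def)
        have part: "\<exists>r S. S \<subseteq> X \<and> card S = t \<and> (\<forall>s\<in>S. s mod 4 = r)"
          if X: "X \<subseteq> {..<n}" "card X = card A" for X
        proof -
          have "finite X" using X by (simp add: finite_subset)
          then obtain r where r: "card X \<le> 4 * card {a \<in> X. a mod 4 = r}"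
            using residue_class_pigeonhole by blast
          then have "real (card A) \<le> 4 * real (card {a \<in> X. a mod 4 = r})"
            using X(2) by linarith
          then have "t \<le> card {a \<in> X. a mod 4 = r}"
            using big unfolding t_def by linarith
          then obtain S where "S \<subseteq> {a \<in> X. a mod 4 = r}" "card S = t"
            by (meson obtain_subset_with_card_n)
          then show ?thesis by blast
        qed
        obtain r S where S: "S \<subseteq> A" "card S = t" "\<forall>s\<in>S. s mod 4 = r" using part[OF sub(1) refl] by blast
        obtain r' S' where S': "S' \<subseteq> B" "card S' = t" "\<forall>s\<in>S'. s mod 4 = r'"
          using part[OF sub(2) cardB] by blast
        have SS: "S \<subseteq> {..<n}" "S' \<subseteq> {..<n}" using S S' sub by auto
        \<comment> \<open>Within a single class any two curves meet. Otherwise the rectangle of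
          \<open>S\<close> and \<open>S'\<close>, taken with the smaller residue first, contains the
          colour \<open>c\<close>.\<close>
        have "\<exists>a\<in>S. \<exists>b\<in>S'. a mod 4 = b mod 4 \<or> R c a b"
        proof -
          consider "r = r'" | "r < r'" | "r' < r" by linarith
          then show ?thesis
          proof cases
            case 1
            have "S \<noteq> {}" "S' \<noteq> {}" using S S' t_pos by auto
            then obtain a b where ab: "a \<in> S" "b \<in> S'" by blast
            moreover have "a mod 4 = b mod 4" using ab S(3) S'(3) 1 by simp
            ultimately show ?thesis by blast
          next
            case 2
            obtain a b where "a \<in> S" "b \<in> S'" "H (a, b) = c"
              using hit[rule_format, of S S' c] SS S(2) S'(2) c(1) by blast
            then show ?thesis using 2 S(3) S'(3) by (auto simp: R_def)
          next
            case 3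
            obtain a b where "a \<in> S" "b \<in> S'" "H (b, a) = c"
              using hit[rule_format, of S' S c] SS S(2) S'(2) c(1) by blast
            then show ?thesis using 3 S(3) S'(3) by (auto simp: R_def)
          qed
        qed
        then obtain a b where ab: "a \<in> S" "b \<in> S'" "a mod 4 = b mod 4 \<or> R c a b" by blast
        have "a \<in> A" "b \<in> B" using ab S S' by auto
        moreover have "a \<noteq> b" using calculation disj by auto
        moreover have "a < n" "b < n" using calculation sub by auto
        ultimately show False
          using nonadj[of a b] curves_meet_iff[of a b] ab(3) by (auto simp: ig_adj_def)
      qed
    qed
  qed
qed

subsection \<open>Counting separated pairs\<close>

text \<open>Turan's theorem with every edge counted twice, by induction on \<open>r\<close>. The
  neighbourhood of a vertex of maximal degree \<open>d\<close> has no clique of the next smaller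
  size, so induction applies to it; the edges with an end outside number at most
  \<open>d * (card W - d)\<close>.\<close>

lemma turan_ordered_pairs:
  fixes E :: "'a \<Rightarrow> 'a \<Rightarrow> bool"
  assumes "1 \<le> r" "finite W" "\<And>x y. E x y \<Longrightarrow> E y x" "\<And>x. \<not> E x x"
    and "\<And>K. K \<subseteq> W \<Longrightarrow> card K = Suc r \<Longrightarrow> \<exists>x\<in>K. \<exists>y\<in>K. x \<noteq> y \<and> \<not> E x y"
  shows "(\<Sum>x\<in>W. real (card {y\<in>W. E x y})) \<le> (1 - 1 / real r) * (real (card W))^2"
  using assms
proof (induction r arbitrary: W rule: dec_induct)
  case base
  have empty: "{y\<in>W. E x y} = {}" if "x \<in> W" for x
  proof (rule ccontr)
    assume "{y\<in>W. E x y} \<noteq> {}"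
    then obtain y where "y \<in> W" "E x y" by blast
    then have "x \<noteq> y" using base.prems by blast
    then have "\<exists>u\<in>{x,y}. \<exists>v\<in>{x,y}. u \<noteq> v \<and> \<not> E u v"
      using base.prems(4)[of "{x, y}"] that \<open>y \<in> W\<close> by auto
    then show False using \<open>E x y\<close> base.prems(2) by blast
  qed
  have "real (card {y\<in>W. E x y}) = 0" if "x \<in> W" for x
    unfolding empty[OF that] by simp
  then show ?case by simp
next
  case (step r)
  note finW = step.prems(1) and sym = step.prems(2) and irr = step.prems(3)
  define deg where "deg x = card {y\<in>W. E x y}" for x
  show ?case
  proof (cases "W = {}")
    case False
    define d where "d = Max (deg ` W)"
    have "d \<in> deg ` W" unfolding d_def using finW False by (intro Max_in) auto
    then obtain v where v: "v \<in> W" "deg v = d" by blast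
    have deg_le: "deg x \<le> d" if "x \<in> W" for x
      unfolding d_def using finW that by (intro Max_ge) auto
    define N where "N = {y\<in>W. E v y}"
    have N: "N \<subseteq> W" "finite N" "card N = d" using finW v by (auto simp: N_def deg_def)
    have fin: "finite {y\<in>X. E x y}" if "X \<subseteq> W" for X x using that finW by (auto intro: finite_subset)
    have IH: "(\<Sum>x\<in>N. real (card {y\<in>N. E x y})) \<le> (1 - 1 / real r) * (real (card N))^2"
    proof (rule step.IH)
      fix K assume K: "K \<subseteq> N" "card K = Suc r"
      have "v \<notin> K" using K irr by (auto simp: N_def)
      moreover have "finite K" using K N finite_subset by blast
      ultimately have "card (insert v K) = Suc (Suc r)" using K by simp
      moreover have "insert v K \<subseteq> W" using K N v by auto
      ultimately obtain x y where xy: "x \<in> insert v K" "y \<in> insert v K" "x \<noteq> y" "\<not> E x y"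
        using step.prems(4) by blast
      have "E v z" if "z \<in> K" for z using that K by (auto simp: N_def)
      then show "\<exists>x\<in>K. \<exists>y\<in>K. x \<noteq> y \<and> \<not> E x y" using xy sym by blast
    qed (use N sym irr in auto)
    have split: "card {y\<in>W. E x y} = card {y\<in>N. E x y} + card {y\<in>W - N. E x y}" for x
    proof -
      have "{y\<in>W. E x y} = {y\<in>N. E x y} \<union> {y\<in>W - N. E x y}" using N by auto
      then show ?thesis using fin[of N x] fin[of "W - N" x] N
        by (simp only: card_Un_disjoint) (subst card_Un_disjoint; auto)
    qed
    have out: "real (deg x) \<le> real d" if "x \<in> W - N" for x using deg_le that by simp
    have cW: "real (card (W - N)) = real (card W) - real d"
      using card_mono[OF finW N(1)] N finW by (simp add: card_Diff_subset of_nat_diff)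
    \<comment> \<open>Pairs leading out of \<open>N\<close> are counted from their outer end, so
      that they are charged to the degrees in \<open>W - N\<close>.\<close>
    have double: "(\<Sum>x\<in>N. card {y\<in>W - N. E x y}) = (\<Sum>y\<in>W - N. card {x\<in>N. E y x})"
    proof -
      have "(\<Sum>x\<in>N. card {y\<in>W - N. E x y}) = (\<Sum>x\<in>N. \<Sum>y\<in>W - N. if E x y then 1 else 0)"
        using finW by (intro sum.cong refl) (simp add: sum.If_cases Int_def)
      also have "\<dots> = (\<Sum>y\<in>W - N. \<Sum>x\<in>N. if E y x then 1 else 0)"
        by (subst sum.swap) (use sym in \<open>auto intro!: sum.cong\<close>)
      also have "\<dots> = (\<Sum>y\<in>W - N. card {x\<in>N. E y x})"
        using N by (intro sum.cong refl) (simp add: sum.If_cases Int_def)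
      finally show ?thesis .
    qed
    have "(\<Sum>x\<in>W. real (deg x)) = (\<Sum>x\<in>N. real (deg x)) + (\<Sum>x\<in>W - N. real (deg x))"
      using N finW by (metis add.commute sum.subset_diff)
    also have "(\<Sum>x\<in>N. real (deg x)) = (\<Sum>x\<in>N. real (card {y\<in>N. E x y})) + real (\<Sum>y\<in>W - N. card {x\<in>N. E y x})"
      by (simp add: deg_def split sum.distrib flip: double)
    also have "real (\<Sum>y\<in>W - N. card {x\<in>N. E y x}) \<le> (\<Sum>y\<in>W - N. real (deg y))"
      unfolding of_nat_sum deg_def using N finW by (intro sum_mono of_nat_mono card_mono) auto
    finally have "(\<Sum>x\<in>W. real (deg x)) \<le> (1 - 1 / real r) * (real d)^2 + 2 * (\<Sum>x\<in>W - N. real (deg x))"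
      using IH N(3) by simp
    also have "(\<Sum>x\<in>W - N. real (deg x)) \<le> real d * (real (card W) - real d)"
      using sum_bounded_above[of "W - N", OF out] cW by (simp add: mult.commute)
    finally have le: "(\<Sum>x\<in>W. real (deg x)) \<le> (1 - 1 / real r) * (real d)^2 + 2 * (real d * (real (card W) - real d))"
      by simp
    have r: "real r > 0" using step.hyps by simp
    \<comment> \<open>The slack in the bound is a perfect square for every \<open>d\<close>, so no
      optimisation over \<open>d\<close> is required.\<close>
    have "(1 - 1 / real (Suc r)) * (real (card W))^2
        - ((1 - 1 / real r) * (real d)^2 + 2 * (real d * (real (card W) - real d)))
      = (real r * real (card W) - (real r + 1) * real d)^2 / (real r * (real r + 1))"
      using r by (simp add: field_simps power2_eq_square)
    also have "\<dots> \<ge> 0" using r by simp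
    finally show ?thesis using le by (simp add: deg_def)
  qed simp
qed

text \<open>Exchanging \<open>x\<close> with the coordinate \<open>f a\<close> is an involution on
  pairs of a sample and an element. Hence redrawing one coordinate does not change the average of
  \<open>g\<close>.\<close>

lemma sum_resample:
  fixes g :: "('i \<Rightarrow> 'a) \<Rightarrow> real"
  assumes "finite I" "finite V" "a \<in> I"
  shows "(\<Sum>f\<in>PiE I (\<lambda>_. V). \<Sum>x\<in>V. g (f(a := x))) = real (card V) * (\<Sum>f\<in>PiE I (\<lambda>_. V). g f)"
proof -
  let ?S = "PiE I (\<lambda>_. V)"
  have upd: "f(a := x) \<in> ?S" if "f \<in> ?S" "x \<in> V" for f x
    using PiE_fun_upd[of x "\<lambda>_. V" a f I] that assms(3) by (simp add: insert_absorb)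
  have mem: "f a \<in> V" if "f \<in> ?S" for f using that assms(3) by (rule PiE_mem)
  have "(\<Sum>f\<in>?S. \<Sum>x\<in>V. g (f(a := x))) = (\<Sum>(f, x)\<in>?S \<times> V. g (f(a := x)))"
    by (rule sum.cartesian_product)
  also have "\<dots> = (\<Sum>(f, x)\<in>?S \<times> V. g f)"
    by (rule sum.reindex_bij_witness[where i = "\<lambda>(f, x). (f(a := x), f a)"
          and j = "\<lambda>(f, x). (f(a := x), f a)"]) (use upd mem in auto)
  also have "\<dots> = (\<Sum>f\<in>?S. \<Sum>x\<in>V. g f)"
    by (rule sum.cartesian_product[symmetric])
  finally show ?thesis by (simp add: sum_distrib_left)
qed

lemma sum_resample2:
  fixes g :: "('i \<Rightarrow> 'a) \<Rightarrow> real"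
  assumes "finite I" "finite V" "a \<in> I" "b \<in> I"
  shows "(\<Sum>f\<in>PiE I (\<lambda>_. V). \<Sum>x\<in>V. \<Sum>y\<in>V. g (f(a := x, b := y)))
    = (real (card V))^2 * (\<Sum>f\<in>PiE I (\<lambda>_. V). g f)"
  using sum_resample[OF assms(1-3), of "\<lambda>f. \<Sum>y\<in>V. g (f(b := y))"]
    sum_resample[OF assms(1,2,4), of g]
  by (simp add: power2_eq_square)

text \<open>
  Each of the five disjuncts says that one diagonal of a pentagon is good for both sequences. Two
  crossing diagonals cannot both be bad for the same sequence, so each sequence spoils at most two.
\<close>

lemma pentagon_diagonal:
  fixes r1 r2 r3 r4 r5 :: real and l1 l2 l3 l4 l5 :: real
  shows "(min r1 r3 \<le> r2 \<and> min l1 l3 \<le> l2)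
    \<or> (min r2 r4 \<le> r3 \<and> min l2 l4 \<le> l3)
    \<or> (min r3 r5 \<le> r4 \<and> min l3 l5 \<le> l4)
    \<or> ((min r1 r4 \<le> r2 \<or> min r1 r4 \<le> r3) \<and> (min l1 l4 \<le> l2 \<or> min l1 l4 \<le> l3))
    \<or> ((min r2 r5 \<le> r3 \<or> min r2 r5 \<le> r4) \<and> (min l2 l5 \<le> l3 \<or> min l2 l5 \<le> l4))"
proof -
  \<comment> \<open>The five conjuncts run around the 5-cycle of crossing diagonals 13, 24, 35, 14,
    25. The bad diagonals of one sequence are therefore independent in that cycle, and two
    independent sets cannot cover its five vertices.\<close>
  have *: "(min x1 x3 \<le> x2 \<or> min x2 x4 \<le> x3) \<and> (min x2 x4 \<le> x3 \<or> min x3 x5 \<le> x4)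
      \<and> (min x3 x5 \<le> x4 \<or> (min x1 x4 \<le> x2 \<or> min x1 x4 \<le> x3))
      \<and> ((min x1 x4 \<le> x2 \<or> min x1 x4 \<le> x3) \<or> (min x2 x5 \<le> x3 \<or> min x2 x5 \<le> x4))
      \<and> ((min x2 x5 \<le> x3 \<or> min x2 x5 \<le> x4) \<or> min x1 x3 \<le> x2)"
    for x1 x2 x3 x4 x5 :: real
    unfolding min_le_iff_disj by linarith
  show ?thesis
    using *[of r1 r3 r2 r4 r5] *[of l1 l3 l2 l4 l5] by blast
qed

section \<open>Disjointness among curves crossing a common vertical line\<close>

text \<open>
  For curves crossing a common vertical line, \<open>D\<close> is disjointness, \<open>h\<close> the height on the
  line, and \<open>r\<close>, \<open>l\<close> measure how far a curve reaches to the right and to the left.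
\<close>

locale crossing_system =
  fixes V :: "'a set" and D :: "'a \<Rightarrow> 'a \<Rightarrow> bool" and h r l :: "'a \<Rightarrow> real"
  assumes fin: "finite V"
    and D_sym: "D u v \<Longrightarrow> D v u"
    and D_height: "D u v \<Longrightarrow> h u \<noteq> h v"
begin

text \<open>On each side of the line \<open>u\<close> and \<open>v\<close> can meet only as far as
  both reach, hence the minima. The right side is guarded by \<open>w\<close>, the left side by
  \<open>w'\<close>; the two may coincide.\<close>

definition separated :: "'a \<Rightarrow> 'a \<Rightarrow> 'a \<Rightarrow> 'a \<Rightarrow> bool" where
  "separated u v w w' \<longleftrightarrow> D u w \<and> D w v \<and> D u w' \<and> D w' v
     \<and> h u < h w \<and> h w < h v \<and> h u < h w' \<and> h w' < h v
     \<and> min (r u) (r v) \<le> r w \<and> min (l u) (l v) \<le> l w'"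

lemma D_irrefl: "\<not> D u u"
  using D_height by blast

text \<open>Sorting the five elements by height makes them the vertices of a pentagon. A diagonal
  that is good for both reaches gives the pair, and vertices between its ends in height serve as
  separators.\<close>

lemma five_clique_separated:
  assumes "card K = 5" "\<And>x y. x \<in> K \<Longrightarrow> y \<in> K \<Longrightarrow> x \<noteq> y \<Longrightarrow> D x y"
  shows "\<exists>u\<in>K. \<exists>v\<in>K. \<exists>w\<in>K. \<exists>w'\<in>K. separated u v w w'"
proof -
  have "finite K" using assms(1) by (metis card.infinite zero_neq_numeral)
  have inj: "inj_on h K" using assms(2) D_height by (meson inj_onI)
  define ys where "ys = sorted_list_of_set (h ` K)"
  have ys: "sorted_wrt (<) ys" "set ys = h ` K" "length ys = 5"
    using \<open>finite K\<close> inj assms(1) by (simp_all add: ys_def card_image)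
  obtain y1 y2 y3 y4 y5 where ys_eq: "ys = [y1, y2, y3, y4, y5]"
    using ys(3) by (auto simp: numeral_eq_Suc length_Suc_conv)
  have "y1 \<in> h ` K" "y2 \<in> h ` K" "y3 \<in> h ` K" "y4 \<in> h ` K" "y5 \<in> h ` K"
    using ys(2) unfolding ys_eq by auto
  then obtain x1 x2 x3 x4 x5 where x: "x1 \<in> K" "x2 \<in> K" "x3 \<in> K" "x4 \<in> K" "x5 \<in> K"
    and hx: "y1 = h x1" "y2 = h x2" "y3 = h x3" "y4 = h x4" "y5 = h x5"
    by blast
  have lt: "h x1 < h x2" "h x2 < h x3" "h x3 < h x4" "h x4 < h x5"
    using ys(1) unfolding ys_eq hx by auto
  have lt': "h x1 < h x3" "h x1 < h x4" "h x2 < h x4" "h x2 < h x5" "h x3 < h x5"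
    using lt by linarith+
  have D: "D x y" if "x \<in> K" "y \<in> K" "h x < h y" for x y
    using assms(2)[OF that(1,2)] that(3) by blast
  have sep: "separated u v w w'" if "u \<in> K" "v \<in> K" "w \<in> K" "w' \<in> K"
    "h u < h w" "h w < h v" "h u < h w'" "h w' < h v"
    "min (r u) (r v) \<le> r w" "min (l u) (l v) \<le> l w'" for u v w w'
    unfolding separated_def using that D by simp
  consider "min (r x1) (r x3) \<le> r x2" "min (l x1) (l x3) \<le> l x2"
    | "min (r x2) (r x4) \<le> r x3" "min (l x2) (l x4) \<le> l x3"
    | "min (r x3) (r x5) \<le> r x4" "min (l x3) (l x5) \<le> l x4"
    | w w' where "w \<in> {x2, x3}" "w' \<in> {x2, x3}" "min (r x1) (r x4) \<le> r w" "min (l x1) (l x4) \<le> l w'"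
    | w w' where "w \<in> {x3, x4}" "w' \<in> {x3, x4}" "min (r x2) (r x5) \<le> r w" "min (l x2) (l x5) \<le> l w'"
    using pentagon_diagonal[of "r x1" "r x3" "r x2" "l x1" "l x3" "l x2" "r x4" "l x4" "r x5" "l x5"]
    by blast
  then show ?thesis
  proof cases
    case 1
    then have "separated x1 x3 x2 x2" using x lt by (intro sep)
    then show ?thesis using x by blast
  next
    case 2
    then have "separated x2 x4 x3 x3" using x lt by (intro sep)
    then show ?thesis using x by blast
  next
    case 3
    then have "separated x3 x5 x4 x4" using x lt by (intro sep)
    then show ?thesis using x by blast
  next
    case (4 w w')
    moreover from 4(1,2) have "w \<in> K" "w' \<in> K" "h x1 < h w" "h w < h x4" "h x1 < h w'" "h w' < h x4"
      using x lt lt' by auto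
    ultimately have "separated x1 x4 w w'" using x by (intro sep)
    then show ?thesis using x \<open>w \<in> K\<close> \<open>w' \<in> K\<close> by blast
  next
    case (5 w w')
    moreover from 5(1,2) have "w \<in> K" "w' \<in> K" "h x2 < h w" "h w < h x5" "h x2 < h w'" "h w' < h x5"
      using x lt lt' by auto
    ultimately have "separated x2 x5 w w'" using x by (intro sep)
    then show ?thesis using x \<open>w \<in> K\<close> \<open>w' \<in> K\<close> by blast
  qed
qed

section \<open>Rarity of separated pairs and the sampling argument\<close>

context
  fixes k :: nat
  assumes sep_D: "\<And>u v w w'. u \<in> V \<Longrightarrow> v \<in> V \<Longrightarrow> w \<in> V \<Longrightarrow> w' \<in> V \<Longrightarrow> separated u v w w' \<Longrightarrow> D u v"
    and no_biclique: "\<And>X Y. X \<subseteq> V \<Longrightarrow> Y \<subseteq> V \<Longrightarrow> (\<And>x y. x \<in> X \<Longrightarrow> y \<in> Y \<Longrightarrow> D x y)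
      \<Longrightarrow> card X < k \<or> card Y < k"
begin

text \<open>Each of the two minima is attained by \<open>u\<close> or by \<open>v\<close>. Fixing
  which of them satisfies which bound decouples the pair into a product set; all pairs in the
  product are separated, hence disjoint, so one of its sides has fewer than \<open>k\<close>
  elements.\<close>

lemma card_separated_le:
  assumes w: "w \<in> V" "w' \<in> V"
  shows "card {(u, v). u \<in> V \<and> v \<in> V \<and> separated u v w w'} \<le> 4 * k * card V"
proof -
  \<comment> \<open>The flags \<open>p\<close> and \<open>s\<close> record whether the right and the
    left bound are met by the lower element; if not, the upper one has to meet them.\<close>
  define below where "below p s = {u\<in>V. D u w \<and> D u w' \<and> h u < h w \<and> h u < h w'
    \<and> (p \<longrightarrow> r u \<le> r w) \<and> (s \<longrightarrow> l u \<le> l w')}" for p s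
  define above where "above p s = {v\<in>V. D w v \<and> D w' v \<and> h w < h v \<and> h w' < h v
    \<and> (\<not> p \<longrightarrow> r v \<le> r w) \<and> (\<not> s \<longrightarrow> l v \<le> l w')}" for p s
  have sub: "below p s \<subseteq> V" "above p s \<subseteq> V" for p s by (auto simp: below_def above_def)
  have small: "card (below p s \<times> above p s) \<le> k * card V" for p s
  proof -
    have "D u v" if "u \<in> below p s" "v \<in> above p s" for u v
    proof (rule sep_D[of u v w w'])
      show "separated u v w w'"
        using that by (cases p; cases s) (auto simp: below_def above_def separated_def)
    qed (use that sub[THEN subsetD] w in auto)
    then have "card (below p s) < k \<or> card (above p s) < k"
      using no_biclique sub by metis
    then show ?thesis
    proof
      assume "card (below p s) < k"
      then have "card (below p s) * card (above p s) \<le> k * card V"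
        by (intro mult_le_mono card_mono fin sub) simp
      then show ?thesis by (simp add: card_cartesian_product)
    next
      assume "card (above p s) < k"
      then have "card (above p s) * card (below p s) \<le> k * card V"
        by (intro mult_le_mono card_mono fin sub) simp
      then show ?thesis by (simp add: card_cartesian_product mult.commute)
    qed
  qed
  have "{(u, v). u \<in> V \<and> v \<in> V \<and> separated u v w w'} \<subseteq> (\<Union>(p, s)\<in>UNIV. below p s \<times> above p s)"
  proof clarify
    fix u v assume uv: "u \<in> V" "v \<in> V" "separated u v w w'"
    then have "(u, v) \<in> below (r u \<le> r w) (l u \<le> l w') \<times> above (r u \<le> r w) (l u \<le> l w')"
      by (auto simp: below_def above_def separated_def min_le_iff_disj)
    then show "(u, v) \<in> (\<Union>(p, s)\<in>UNIV. below p s \<times> above p s)" by blast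
  qed
  then have "card {(u, v). u \<in> V \<and> v \<in> V \<and> separated u v w w'}
      \<le> card (\<Union>(p, s)\<in>(UNIV :: (bool \<times> bool) set). below p s \<times> above p s)"
    by (rule card_mono[rotated]) (use finite_subset[OF sub(1) fin] finite_subset[OF sub(2) fin] in auto)
  also have "\<dots> \<le> (\<Sum>(p, s)\<in>(UNIV :: (bool \<times> bool) set). card (below p s \<times> above p s))"
    unfolding case_prod_unfold by (rule card_UN_le) simp
  also have "\<dots> \<le> (\<Sum>(p, s)\<in>(UNIV :: (bool \<times> bool) set). k * card V)"
    unfolding case_prod_unfold by (intro sum_mono small)
  also have "\<dots> = 4 * k * card V"
    by (simp add: case_prod_unfold card_UNIV_bool card_cartesian_product flip: UNIV_Times_UNIV)
  finally show ?thesis .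
qed

text \<open>
  Sample \<open>m\<close> elements of \<open>V\<close> with repetition: a sample without a separated quadruple has no
  5-clique, hence few disjoint pairs by Turan's theorem, and separated quadruples are rare.
\<close>

lemma disjoint_pairs_bound:
  assumes "V \<noteq> {}"
  shows "real (m * (m - 1)) * (\<Sum>x\<in>V. real (card {y\<in>V. D x y}))
    \<le> 3/4 * (real m)^2 * (real (card V))^2 + 4 * (real m)^6 * real k * real (card V)"
proof -
  let ?n = "real (card V)"
  define S where "S = PiE {..<m} (\<lambda>_. V)"
  define P where "P = (SIGMA a:{..<m}. {..<m} - {a})"
  define Q where "Q = {..<m} \<times> {..<m} \<times> {..<m} \<times> {..<m}"
  define e where "e f = (\<Sum>(a, b)\<in>P. of_bool (D (f a) (f b)) :: real)" for f
  define s where "s f = (\<Sum>(a, b, c, d)\<in>Q. of_bool (separated (f a) (f b) (f c) (f d)) :: real)" for f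
  define N where "N = (\<Sum>x\<in>V. real (card {y\<in>V. D x y}))"
  have finPQ: "finite P" "finite Q" by (auto simp: P_def Q_def)
  have cardP: "card P = m * (m - 1)" by (simp add: P_def card_SigmaI)
  have cardQ: "real (card Q) = (real m)^4"
    by (simp add: Q_def card_cartesian_product power4_eq_xxxx)
  have cardS: "real (card S) > 0"
    using assms fin by (simp add: S_def card_PiE card_gt_0_iff)
  have S_in: "f a \<in> V" if "f \<in> S" "a < m" for f a
    using that by (auto simp: S_def)
  \<comment> \<open>One separated quadruple already makes the second term exceed the trivial bound
    \<open>m^2\<close>. Without any, Turan's theorem for cliques of size 5 gives the factor
    3/4.\<close>
  have pointwise: "e f \<le> 3/4 * (real m)^2 + (real m)^2 * s f" if f: "f \<in> S" for f
  proof (cases "\<exists>(a, b, c, d)\<in>Q. separated (f a) (f b) (f c) (f d)")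
    case True
    then obtain q where q: "q \<in> Q" "(\<lambda>(a, b, c, d). separated (f a) (f b) (f c) (f d)) q" by blast
    have "(1::real) = (\<lambda>(a, b, c, d). of_bool (separated (f a) (f b) (f c) (f d))) q"
      using q(2) by (simp add: case_prod_unfold)
    also have "\<dots> \<le> s f"
      unfolding s_def by (rule member_le_sum[OF q(1)]) (auto simp: finPQ)
    finally have "(real m)^2 \<le> (real m)^2 * s f" by (simp add: mult_le_cancel_left1)
    moreover have "e f \<le> (\<Sum>(a, b)\<in>P. 1)"
      unfolding e_def by (rule sum_mono) auto
    then have "e f \<le> real (m * (m - 1))" using cardP by (simp add: case_prod_unfold)
    then have "e f \<le> (real m)^2"
      by (rule order_trans) (simp add: power2_eq_square mult_left_mono)
    moreover have "0 \<le> (real m)^2" by simp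
    ultimately show ?thesis by linarith
  next
    case False
    have "e f = real (card {(a, b)\<in>P. D (f a) (f b)})"
      unfolding e_def using finPQ by (simp add: case_prod_unfold Int_def)
    also have "{(a, b)\<in>P. D (f a) (f b)} = (SIGMA a:{..<m}. {b\<in>{..<m}. D (f a) (f b)})"
      using D_irrefl by (auto simp: P_def)
    also have "real (card \<dots>) = (\<Sum>a<m. real (card {b\<in>{..<m}. D (f a) (f b)}))"
      by (simp add: card_SigmaI)
    also have "\<dots> \<le> (1 - 1 / real 4) * (real (card {..<m}))^2"
    proof (rule turan_ordered_pairs)
      fix K assume K: "K \<subseteq> {..<m}" "card K = Suc 4"
      show "\<exists>a\<in>K. \<exists>b\<in>K. a \<noteq> b \<and> \<not> D (f a) (f b)"
      proof (rule ccontr)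
        assume "\<not> ?thesis"
        then have cl: "D (f a) (f b)" if "a \<in> K" "b \<in> K" "a \<noteq> b" for a b using that by blast
        \<comment> \<open>A sample may repeat elements, but indices forming a clique carry distinct
          ones because \<open>D\<close> is irreflexive.\<close>
        have "inj_on f K" by (rule inj_onI) (use cl D_irrefl in metis)
        then have "card (f ` K) = 5" using K by (simp add: card_image)
        then have "\<exists>u\<in>f ` K. \<exists>v\<in>f ` K. \<exists>w\<in>f ` K. \<exists>w'\<in>f ` K. separated u v w w'"
          by (rule five_clique_separated) (use cl in blast)
        then obtain a b c d where "a \<in> K" "b \<in> K" "c \<in> K" "d \<in> K" "separated (f a) (f b) (f c) (f d)"
          by blast
        then have "(a, b, c, d) \<in> Q" using K(1) unfolding Q_def by blast
        then show False using False \<open>separated (f a) (f b) (f c) (f d)\<close> by blast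
      qed
    qed (use D_sym D_irrefl in auto)
    finally have "e f \<le> 3/4 * (real m)^2" by simp
    moreover have "0 \<le> (real m)^2 * s f"
      unfolding s_def by (intro mult_nonneg_nonneg sum_nonneg) auto
    ultimately show ?thesis by linarith
  qed
  \<comment> \<open>Two different indices of a random sample carry a uniformly distributed ordered
    pair of elements of \<open>V\<close>.\<close>
  have pair: "?n^2 * (\<Sum>f\<in>S. of_bool (D (f a) (f b))) = real (card S) * N"
    if "(a, b) \<in> P" for a b
  proof -
    have ab: "a < m" "b < m" "a \<noteq> b" using that by (auto simp: P_def)
    have "?n^2 * (\<Sum>f\<in>S. of_bool (D (f a) (f b)))
      = (\<Sum>f\<in>S. \<Sum>x\<in>V. \<Sum>y\<in>V. of_bool (D ((f(a := x, b := y)) a) ((f(a := x, b := y)) b)))"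
      unfolding S_def
      by (rule sum_resample2[of "{..<m}" V a b "\<lambda>f. of_bool (D (f a) (f b))", symmetric]) (use ab fin in auto)
    also have "\<dots> = (\<Sum>f\<in>S. N)"
      unfolding N_def using ab fin by (intro sum.cong refl) (simp add: Int_def)
    finally show ?thesis by simp
  qed
  have quad: "?n^2 * (\<Sum>f\<in>S. of_bool (separated (f a) (f b) (f c) (f d))) \<le> real (card S) * (4 * real k * ?n)"
    if "(a, b, c, d) \<in> Q" for a b c d
  \<comment> \<open>A separated quadruple forces all indices apart except possibly
    \<open>c = d\<close>. So redrawing the coordinates \<open>a\<close> and \<open>b\<close> leaves
    both separators fixed.\<close>
  proof (cases "a = b \<or> c \<in> {a, b} \<or> d \<in> {a, b}")
    case True
    then have "\<not> separated (f a) (f b) (f c) (f d)" for f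
      using D_irrefl by (auto simp: separated_def)
    then show ?thesis by simp
  next
    case False
    have lt: "a < m" "b < m" "c < m" "d < m" using that by (auto simp: Q_def)
    have "?n^2 * (\<Sum>f\<in>S. of_bool (separated (f a) (f b) (f c) (f d)))
      = (\<Sum>f\<in>S. \<Sum>x\<in>V. \<Sum>y\<in>V. of_bool (separated ((f(a := x, b := y)) a) ((f(a := x, b := y)) b)
          ((f(a := x, b := y)) c) ((f(a := x, b := y)) d)))"
      unfolding S_def
      by (rule sum_resample2[of "{..<m}" V a b "\<lambda>f. of_bool (separated (f a) (f b) (f c) (f d))", symmetric])
        (use lt fin in auto)
    also have "\<dots> \<le> (\<Sum>f\<in>S. 4 * real k * ?n)"
    proof (rule sum_mono)
      fix f assume f: "f \<in> S"
      have "(\<Sum>x\<in>V. \<Sum>y\<in>V. of_bool (separated ((f(a := x, b := y)) a) ((f(a := x, b := y)) b)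
          ((f(a := x, b := y)) c) ((f(a := x, b := y)) d)) :: real)
        = (\<Sum>(x, y)\<in>V \<times> V. of_bool (separated x y (f c) (f d)))"
        unfolding sum.cartesian_product using False by (intro sum.cong refl) auto
      also have "\<dots> = real (card {(x, y). x \<in> V \<and> y \<in> V \<and> separated x y (f c) (f d)})"
      proof -
        have "(V \<times> V) \<inter> {z. separated (fst z) (snd z) (f c) (f d)}
          = {(x, y). x \<in> V \<and> y \<in> V \<and> separated x y (f c) (f d)}" by auto
        then show ?thesis using fin by (simp add: case_prod_unfold)
      qed
      also have "\<dots> \<le> real (4 * k * card V)"
        using card_separated_le[of "f c" "f d"] S_in[OF f] lt by (simp only: of_nat_le_iff)
      finally show "(\<Sum>x\<in>V. \<Sum>y\<in>V. of_bool (separated ((f(a := x, b := y)) a) ((f(a := x, b := y)) b)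
          ((f(a := x, b := y)) c) ((f(a := x, b := y)) d)) :: real) \<le> 4 * real k * ?n" by simp
    qed
    finally show ?thesis by simp
  qed
  \<comment> \<open>Sum the pointwise bound over all samples. The exponent 6 arises from the
    \<open>m^2\<close> there and the \<open>m^4\<close> index quadruples.\<close>
  have "real (card S) * (real (m * (m - 1)) * N) = (\<Sum>(a, b)\<in>P. ?n^2 * (\<Sum>f\<in>S. of_bool (D (f a) (f b))))"
    using pair by (subst sum.cong[OF refl, of P _ "\<lambda>_. real (card S) * N"]) (auto simp: cardP)
  also have "\<dots> = ?n^2 * (\<Sum>f\<in>S. e f)"
    unfolding e_def case_prod_unfold sum_distrib_left by (rule sum.swap)
  also have "\<dots> \<le> ?n^2 * (\<Sum>f\<in>S. 3/4 * (real m)^2 + (real m)^2 * s f)"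
    by (intro mult_left_mono sum_mono pointwise) auto
  also have "\<dots> = real (card S) * (3/4 * (real m)^2 * ?n^2) + (real m)^2 * (?n^2 * (\<Sum>f\<in>S. s f))"
  proof -
    have "(\<Sum>f\<in>S. 3/4 * (real m)^2 + (real m)^2 * s f)
        = real (card S) * (3/4 * (real m)^2) + (real m)^2 * (\<Sum>f\<in>S. s f)"
      by (simp add: sum.distrib sum_distrib_left)
    then show ?thesis by (simp only: distrib_left mult_ac)
  qed
  also have "?n^2 * (\<Sum>f\<in>S. s f)
      = (\<Sum>(a, b, c, d)\<in>Q. ?n^2 * (\<Sum>f\<in>S. of_bool (separated (f a) (f b) (f c) (f d))))"
    unfolding s_def case_prod_unfold sum_distrib_left by (rule sum.swap)
  also have "\<dots> \<le> (\<Sum>(a, b, c, d)\<in>Q. real (card S) * (4 * real k * ?n))"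
    by (rule sum_mono) (use quad in auto)
  also have "\<dots> = (real m)^4 * (real (card S) * (4 * real k * ?n))"
    by (simp add: case_prod_unfold cardQ)
  finally have "real (card S) * (real (m * (m - 1)) * N)
      \<le> real (card S) * (3/4 * (real m)^2 * ?n^2) + (real m)^2 * ((real m)^4 * (real (card S) * (4 * real k * ?n)))"
    by (simp add: mult_left_mono)
  also have "\<dots> = real (card S) * (3/4 * (real m)^2 * ?n^2 + 4 * (real m)^6 * real k * ?n)"
    by (simp add: algebra_simps power_add[symmetric, of "real m" 2 4, simplified])
  finally show ?thesis unfolding N_def[symmetric] using cardS by simp
qed

end

end

subsection \<open>Linear bi-cliques below density one quarter\<close>

text \<open>The first projection is a continuous injection on a compact set, so its inverse is
  continuous; its image is compact and connected, hence a closed interval.\<close>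

lemma x_monotone_curve_is_graph:
  assumes "is_curve C" "x_monotone C"
  shows "\<exists>a b f. a \<le> b \<and> continuous_on {a..b} f \<and> C = graph_over a b f"
proof -
  obtain p :: "real \<Rightarrow> real \<times> real" where p: "continuous_on {0..1} p" "p ` {0..1} = C"
    using assms(1) by (auto simp: is_curve_def)
  have C: "compact C" "connected C" "C \<noteq> {}"
    using compact_continuous_image[OF p(1)] connected_continuous_image[OF p(1)] p(2) by auto
  have cfst: "continuous_on C fst" by (intro continuous_intros)
  have "connected (fst ` C) \<and> compact (fst ` C)"
    using compact_continuous_image[OF cfst C(1)] connected_continuous_image[OF cfst C(2)] by simp
  then obtain a b where ab: "fst ` C = {a..b}"
    unfolding connected_compact_interval_1 by (elim exE)
  have inj: "inj_on fst C" using assms(2) by (auto simp: x_monotone_def inj_on_def)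
  define g where "g = inv_into C fst"
  have g: "g (fst z) = z" if "z \<in> C" for z using inj that by (simp add: g_def)
  have "continuous_on (fst ` C) g"
    by (rule continuous_on_inv[OF cfst C(1)]) (use g in auto)
  then have "continuous_on {a..b} (\<lambda>x. snd (g x))"
    unfolding ab by (intro continuous_intros)
  moreover have "C = graph_over a b (\<lambda>x. snd (g x))"
    unfolding graph_over_def ab[symmetric] image_image using g by (auto simp: image_iff)
  moreover have "a \<le> b" using C(3) ab by fastforce
  ultimately show ?thesis by blast
qed

text \<open>Intermediate value theorem: a change of order on a common interval would produce a
  common point.\<close>

lemma graph_stays_below:
  assumes cont: "continuous_on {a..b} f" "continuous_on {c..d} g"
    and disj: "graph_over a b f \<inter> graph_over c d g = {}"
    and sub: "{s..t} \<subseteq> {a..b}" "{s..t} \<subseteq> {c..d}"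
    and p: "p \<in> {s..t}" "f p < g p" and x: "x \<in> {s..t}"
  shows "f x < g x"
proof (rule ccontr)
  assume "\<not> f x < g x"
  have "continuous_on {s..t} (\<lambda>z. f z - g z)"
    using continuous_on_subset[OF cont(1) sub(1)] continuous_on_subset[OF cont(2) sub(2)]
    by (rule continuous_on_diff)
  then have "connected ((\<lambda>z. f z - g z) ` {s..t})"
    by (rule connected_continuous_image) simp
  then have "0 \<in> (\<lambda>z. f z - g z) ` {s..t}"
    by (rule connectedD_interval[of _ "f p - g p" "f x - g x"]) (use p x \<open>\<not> f x < g x\<close> in auto)
  then obtain z where "z \<in> {s..t}" "f z = g z" by auto
  then have "graph_over a b f \<inter> graph_over c d g \<noteq> {}"
    unfolding graph_over_meet_iff using sub by (intro exI[of _ z]) auto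
  then show False using disj by simp
qed

text \<open>The \<open>k\<close>-th smallest value, with two counts because of possible ties. It is
  applied to the right ends of the curves.\<close>

lemma order_statistic:
  fixes b :: "nat \<Rightarrow> real"
  assumes "0 < k" "k \<le> n"
  shows "\<exists>x. card {i. i < n \<and> b i < x} < k \<and> k \<le> card {i. i < n \<and> b i \<le> x}"
proof -
  define T where "T = {x \<in> b ` {..<n}. k \<le> card {i. i < n \<and> b i \<le> x}}"
  have fin: "finite T" by (simp add: T_def)
  have "Max (b ` {..<n}) \<in> T"
  proof -
    have "{i. i < n \<and> b i \<le> Max (b ` {..<n})} = {..<n}" by auto
    then show ?thesis using assms by (auto simp: T_def intro!: Max_in)
  qed
  then have "Min T \<in> T" using fin by (intro Min_in) auto
  moreover have "card {i. i < n \<and> b i < Min T} < k"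
  proof (rule ccontr)
    assume not_less: "\<not> ?thesis"
    define L where "L = {i. i < n \<and> b i < Min T}"
    have finL: "finite L" by (simp add: L_def)
    have "card L \<noteq> 0" using not_less assms(1) unfolding L_def by linarith
    then have "L \<noteq> {}" by auto
    then have M: "Max (b ` L) \<in> b ` L" using finL by (intro Max_in) auto
    have "L \<subseteq> {i. i < n \<and> b i \<le> Max (b ` L)}" using finL by (auto simp: L_def)
    then have "card L \<le> card {i. i < n \<and> b i \<le> Max (b ` L)}" by (intro card_mono) auto
    then have "Max (b ` L) \<in> T" using M not_less by (auto simp: T_def L_def)
    then have "Min T \<le> Max (b ` L)" using fin by simp
    then show False using M by (auto simp: L_def)
  qed
  ultimately show ?thesis by (auto simp: T_def)
qed

text \<open>Take \<open>x0\<close> to be the \<open>k\<close>-th smallest right end. The curves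
  ending by \<open>x0\<close> are disjoint from those starting after it, so fewer than
  \<open>k\<close> start after it, and at most \<open>2 * k\<close> curves miss the line at
  \<open>x0\<close>. The others form a crossing system.\<close>

lemma few_disjoint_pairs_without_biclique:
  fixes C :: "nat \<Rightarrow> (real \<times> real) set"
  assumes curves: "\<And>i. i < n \<Longrightarrow> is_curve (C i)" "\<And>i. i < n \<Longrightarrow> x_monotone (C i)"
    and k: "0 < k" "2 * k < n"
    and no_biclique: "\<And>A B. compl_biclique C n A B \<Longrightarrow> card A < k"
  shows "real (m * (m - 1)) * (real n * (real n - 1) - 2 * real (card (ig_edges C n)) - 4 * real k * real n)
    \<le> 3/4 * (real m)^2 * (real n)^2 + 4 * (real m)^6 * real k * real n"
proof -
  have "\<exists>a b f. \<forall>i<n. a i \<le> b i \<and> continuous_on {a i..b i} (f i) \<and> C i = graph_over (a i) (b i) (f i)"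
    using x_monotone_curve_is_graph[OF curves] by metis
  then obtain a b :: "nat \<Rightarrow> real" and f :: "nat \<Rightarrow> real \<Rightarrow> real" where
    ab: "\<And>i. i < n \<Longrightarrow> a i \<le> b i" and cont: "\<And>i. i < n \<Longrightarrow> continuous_on {a i..b i} (f i)"
    and C: "\<And>i. i < n \<Longrightarrow> C i = graph_over (a i) (b i) (f i)"
    by blast
  have biclique: "card X < k \<or> card Y < k"
    if XY: "X \<subseteq> {..<n}" "Y \<subseteq> {..<n}" "X \<inter> Y = {}" "\<And>x y. x \<in> X \<Longrightarrow> y \<in> Y \<Longrightarrow> C x \<inter> C y = {}" for X Y
  proof (rule ccontr)
    assume "\<not> ?thesis"
    then have "k \<le> card X" "k \<le> card Y" by auto
    then obtain A B where A: "A \<subseteq> X" "card A = k" "finite A" and B: "B \<subseteq> Y" "card B = k"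
      by (meson obtain_subset_with_card_n)
    have "\<forall>x\<in>A. \<forall>y\<in>B. C x \<inter> C y = {}" using A(1) B(1) XY(4) by blast
    moreover have "A \<subseteq> {..<n}" "B \<subseteq> {..<n}" "A \<inter> B = {}" using A(1) B(1) XY(1-3) by auto
    ultimately have "compl_biclique C n A B"
      using A B by (simp add: compl_biclique_def ig_adj_def)
    then show False using no_biclique A(2) by blast
  qed
  obtain x0 where x0: "card {i. i < n \<and> b i < x0} < k" "k \<le> card {i. i < n \<and> b i \<le> x0}"
    using order_statistic[of k n b] k by auto
  define V where "V = {i. i < n \<and> a i \<le> x0 \<and> x0 \<le> b i}"
  define bad where "bad = {..<n} - V"
  have right: "card {i. i < n \<and> x0 < a i} < k"
  proof -
    have "C i \<inter> C j = {}" if "i < n" "b i \<le> x0" "j < n" "x0 < a j" for i j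
      using that by (auto simp: C graph_over_def)
    then have "card {i. i < n \<and> b i \<le> x0} < k \<or> card {i. i < n \<and> x0 < a i} < k"
      by (intro biclique) (use ab in fastforce)+
    then show ?thesis using x0(2) by simp
  qed
  have card_bad: "card bad \<le> 2 * k"
  proof -
    have "bad \<subseteq> {i. i < n \<and> b i < x0} \<union> {i. i < n \<and> x0 < a i}"
      by (auto simp: bad_def V_def)
    then have "card bad \<le> card ({i. i < n \<and> b i < x0} \<union> {i. i < n \<and> x0 < a i})"
      by (rule card_mono[rotated]) auto
    also have "\<dots> \<le> card {i. i < n \<and> b i < x0} + card {i. i < n \<and> x0 < a i}" by (rule card_Un_le)
    finally show ?thesis using x0(1) right by simp
  qed
  have V: "V \<subseteq> {..<n}" "finite V" by (auto simp: V_def)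
  have V_ne: "V \<noteq> {}"
  proof
    assume "V = {}"
    then show False using card_bad k(2) by (simp add: bad_def)
  qed
  define D where "D i j \<longleftrightarrow> i \<in> V \<and> j \<in> V \<and> C i \<inter> C j = {}" for i j
  \<comment> \<open>Left ends are negated so that larger values mean a farther reach on both
    sides.\<close>
  interpret crossing_system V D "\<lambda>i. f i x0" b "\<lambda>i. - a i"
  proof
    show "f u x0 \<noteq> f v x0" if "D u v" for u v
    proof
      assume "f u x0 = f v x0"
      moreover have uv: "u \<in> V" "v \<in> V" using that by (simp_all add: D_def)
      ultimately have "graph_over (a u) (b u) (f u) \<inter> graph_over (a v) (b v) (f v) \<noteq> {}"
        unfolding graph_over_meet_iff V_def by (intro exI[of _ x0]) simp
      then have "C u \<inter> C v \<noteq> {}" using uv by (simp add: V_def C)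
      then show False using that by (simp add: D_def)
    qed
  qed (use V in \<open>auto simp: D_def Int_commute\<close>)
  have below: "f u x < f v x"
    if "D u v" "f u x0 < f v x0" "a u \<le> x" "x \<le> b u" "a v \<le> x" "x \<le> b v" for u v x
  proof (rule graph_stays_below[of "a u" "b u" "f u" "a v" "b v" "f v" "min x x0" "max x x0" x0])
    have uv: "u < n" "v < n" "u \<in> V" "v \<in> V" using that(1) V by (auto simp: D_def)
    then show "continuous_on {a u..b u} (f u)" "continuous_on {a v..b v} (f v)" using cont by auto
    show "graph_over (a u) (b u) (f u) \<inter> graph_over (a v) (b v) (f v) = {}"
      using that(1) uv by (simp add: D_def C)
    show "{min x x0..max x x0} \<subseteq> {a u..b u}" "{min x x0..max x x0} \<subseteq> {a v..b v}"
      using uv that by (auto simp: V_def)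
  qed (use that in auto)
  have sep_D: "D u v" if "u \<in> V" "v \<in> V" "w \<in> V" "w' \<in> V" "separated u v w w'" for u v w w'
  proof (rule ccontr)
    assume "\<not> D u v"
    then have "graph_over (a u) (b u) (f u) \<inter> graph_over (a v) (b v) (f v) \<noteq> {}"
      using that(1,2) by (simp add: D_def V_def C)
    then obtain x where x: "a u \<le> x" "x \<le> b u" "a v \<le> x" "x \<le> b v" "f u x = f v x"
      unfolding graph_over_meet_iff by blast
    have s: "D u w" "D w v" "D u w'" "D w' v" "f u x0 < f w x0" "f w x0 < f v x0"
      "f u x0 < f w' x0" "f w' x0 < f v x0" "min (b u) (b v) \<le> b w" "min (- a u) (- a v) \<le> - a w'"
      using that(5) by (auto simp: separated_def)
    \<comment> \<open>A common point of \<open>u\<close> and \<open>v\<close> lies within the reach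
      of the separator responsible for its side, which would have to pass strictly between them
      there.\<close>
    have "\<exists>z\<in>{w, w'}. a z \<le> x \<and> x \<le> b z"
    proof (cases "x0 \<le> x")
      case True
      then have "a w \<le> x" using that(3) by (auto simp: V_def)
      moreover have "x \<le> b w" using s(9) x by auto
      ultimately show ?thesis by blast
    next
      case False
      then have "x \<le> b w'" using that(4) by (auto simp: V_def)
      moreover have "a w' \<le> x" using s(10) x by auto
      ultimately show ?thesis by blast
    qed
    then obtain z where z: "z \<in> {w, w'}" "a z \<le> x" "x \<le> b z" by blast
    then have "D u z" "D z v" "f u x0 < f z x0" "f z x0 < f v x0" using s by auto
    note * = this
    have "f u x < f z x" by (rule below[OF *(1,3)]) (use x z in auto)
    moreover have "f z x < f v x" by (rule below[OF *(2,4)]) (use x z in auto)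
    ultimately show False using x(5) by simp
  qed
  have no_big: "card X < k \<or> card Y < k"
    if "X \<subseteq> V" "Y \<subseteq> V" "\<And>x y. x \<in> X \<Longrightarrow> y \<in> Y \<Longrightarrow> D x y" for X Y
  proof (rule biclique)
    show "X \<inter> Y = {}" using that(3) D_irrefl by blast
    show "C x \<inter> C y = {}" if "x \<in> X" "y \<in> Y" for x y
      using \<open>\<And>x y. x \<in> X \<Longrightarrow> y \<in> Y \<Longrightarrow> D x y\<close>[OF that] by (simp add: D_def)
  qed (use that V in auto)
  define N where "N = (\<Sum>x\<in>V. real (card {y\<in>V. D x y}))"
  have main: "real (m * (m - 1)) * N
      \<le> 3/4 * (real m)^2 * (real (card V))^2 + 4 * (real m)^6 * real k * real (card V)"
    unfolding N_def by (rule disjoint_pairs_bound[OF sep_D no_big V_ne])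
  have cV: "real (card V) \<le> real n" using card_mono[OF _ V(1)] by simp
  \<comment> \<open>Every ordered pair is disjoint inside \<open>V\<close>, or an edge in one of two
    orders, or involves one of the at most \<open>2 * k\<close> curves missing the line, in either
    position.\<close>
  have "real n * (real n - 1) \<le> N + 2 * real (card (ig_edges C n)) + 4 * real k * real n"
  proof -
    define E where "E = ig_edges C n"
    define P where "P = (SIGMA i:{..<n}. {..<n} - {i})"
    define Q where "Q = (SIGMA x:V. {y\<in>V. D x y})"
    have finE: "finite E" unfolding E_def ig_edges_def by (rule finite_ordered_pairs)
    have fins: "finite bad" "finite Q" using V by (auto simp: bad_def Q_def)
    have "P \<subseteq> Q \<union> (E \<union> (prod.swap ` E \<union> (bad \<times> {..<n} \<union> {..<n} \<times> bad)))"
    proof (rule subsetI, rule ccontr)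
      fix z assume "z \<in> P" and no: "z \<notin> Q \<union> (E \<union> (prod.swap ` E \<union> (bad \<times> {..<n} \<union> {..<n} \<times> bad)))"
      obtain i j where z: "z = (i, j)" by (cases z)
      have ij: "i < n" "j < n" "i \<noteq> j" using \<open>z \<in> P\<close> by (auto simp: P_def z)
      then have iV: "i \<in> V" "j \<in> V" using no by (auto simp: bad_def z)
      have "(i, j) \<notin> E" "(j, i) \<notin> E" using no unfolding z by force+
      then have "C i \<inter> C j = {}"
        using ij by (cases "i < j") (auto simp: E_def ig_edges_def ig_adj_def)
      then show False using iV no by (simp add: Q_def D_def z)
    qed
    then have "card P \<le> card (Q \<union> (E \<union> (prod.swap ` E \<union> (bad \<times> {..<n} \<union> {..<n} \<times> bad))))"
      using finE fins by (intro card_mono) auto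
    also have "\<dots> \<le> card Q + (card E + (card (prod.swap ` E) + (card (bad \<times> {..<n}) + card ({..<n} \<times> bad))))"
      by (intro order_trans[OF card_Un_le] add_mono order_refl)
    also have "\<dots> \<le> card Q + (card E + (card E + (2 * k * n + n * (2 * k))))"
      using card_bad by (intro add_mono card_image_le finE) (auto simp: card_cartesian_product)
    finally have "real (card P) \<le> real (card Q + (card E + (card E + (2 * k * n + n * (2 * k)))))"
      by (rule of_nat_mono)
    moreover have "real (card P) = real n * (real n - 1)"
      using k by (simp add: P_def card_SigmaI of_nat_diff)
    moreover have "real (card Q) = N" using V by (simp add: Q_def N_def card_SigmaI)
    ultimately show ?thesis by (simp add: E_def)
  qed
  then have "real (m * (m - 1)) * (real n * (real n - 1) - 2 * real (card (ig_edges C n)) - 4 * real k * real n)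
      \<le> real (m * (m - 1)) * N"
    by (intro mult_left_mono) auto
  also note main
  also have "3/4 * (real m)^2 * (real (card V))^2 + 4 * (real m)^6 * real k * real (card V)
      \<le> 3/4 * (real m)^2 * (real n)^2 + 4 * (real m)^6 * real k * real n"
    using cV by (intro add_mono mult_left_mono power_mono) auto
  finally show ?thesis .
qed

text \<open>The sample size \<open>m\<close> is chosen first, of order
  \<open>1 / \<epsilon>\<close>, so that the loss from \<open>m * (m - 1)\<close> against
  \<open>m^2\<close> is below the gain in density. Then \<open>c\<close> is made so small that the
  term with \<open>m^6\<close> is negligible too.\<close>

lemma sparse_curves_have_linear_biclique:
  fixes \<epsilon> :: real
  assumes "\<epsilon> > 0"
  shows "\<exists>c>0. \<exists>n0 :: nat. \<forall>n\<ge>n0. \<forall>C :: nat \<Rightarrow> (real \<times> real) set.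
        (\<forall>i<n. is_curve (C i) \<and> x_monotone (C i)) \<and>
        real (card (ig_edges C n)) \<le> (1/4 - \<epsilon>) * real (n choose 2) \<longrightarrow>
        (\<exists>A B. compl_biclique C n A B \<and> real (card A) \<ge> c * real n)"
proof -
  define m where "m = nat \<lceil>3 / \<epsilon>\<rceil> + 2"
  define M where "M = real m"
  have M2: "2 \<le> M" by (simp add: M_def m_def)
  have "3 / \<epsilon> + 2 \<le> M" unfolding M_def m_def by linarith
  then have Me: "3 + 2 * \<epsilon> \<le> \<epsilon> * M" using assms by (simp add: field_simps)
  \<comment> \<open>The power \<open>M^4\<close> remains from \<open>m^6\<close> after division by
    \<open>m^2\<close>. The factor \<open>1 + \<epsilon>\<close> also keeps \<open>c\<close> small
    when \<open>\<epsilon>\<close> is large, which yields \<open>4 * c < 1\<close> and thus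
    \<open>2 * k < n\<close>.\<close>
  define c where "c = \<epsilon> / ((1 + \<epsilon>) * 64 * M^4)"
  have M4: "1 \<le> M^4" using M2 by (simp add: one_le_power)
  have c_pos: "c > 0" using assms M2 by (simp add: c_def)
  have "(1 + \<epsilon>) * 64 * M^4 \<noteq> 0" using assms M2 by simp
  then have "c * ((1 + \<epsilon>) * 64 * M^4) = \<epsilon>" by (simp add: c_def)
  then have cM: "64 * ((1 + \<epsilon>) * (M^4 * c)) = \<epsilon>" by (simp only: mult_ac)
  have c1: "64 * ((1 + \<epsilon>) * c) \<le> \<epsilon>"
  proof -
    have "1 * ((1 + \<epsilon>) * c) \<le> M^4 * ((1 + \<epsilon>) * c)"
      using M4 c_pos assms by (intro mult_right_mono) auto
    moreover have "M^4 * ((1 + \<epsilon>) * c) = (1 + \<epsilon>) * (M^4 * c)" by (simp only: mult_ac)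
    ultimately show ?thesis using cM by linarith
  qed
  have c2: "64 * (M^4 * c) \<le> \<epsilon>"
  proof -
    have "0 \<le> \<epsilon> * (M^4 * c)" using M4 c_pos assms by simp
    then show ?thesis using cM by (simp add: algebra_simps)
  qed
  have c3: "4 * c < 1"
  proof -
    note c1
    also have "\<epsilon> < (1 + \<epsilon>) * 1" by simp
    finally have "(1 + \<epsilon>) * (64 * c) < (1 + \<epsilon>) * 1" by (simp only: mult_ac)
    then have "64 * c < 1" using assms by (simp only: mult_less_cancel_left_pos)
    then show ?thesis using c_pos by linarith
  qed
  show ?thesis
  \<comment> \<open>From \<open>1 / c\<close> on, \<open>c * n\<close> is at least 1, so rounding it
    up to \<open>k\<close> at most doubles it.\<close>
  proof (intro exI[of _ c] exI[of _ "nat \<lceil>1 / c\<rceil> + 2"] conjI allI impI c_pos)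
    fix n :: nat and C :: "nat \<Rightarrow> (real \<times> real) set"
    assume n: "nat \<lceil>1 / c\<rceil> + 2 \<le> n"
      and C: "(\<forall>i<n. is_curve (C i) \<and> x_monotone (C i)) \<and>
        real (card (ig_edges C n)) \<le> (1/4 - \<epsilon>) * real (n choose 2)"
    define x where "x = real n"
    have x2: "2 \<le> x" using n by (simp add: x_def)
    have "1 / c \<le> x" using n unfolding x_def by linarith
    then have cx: "1 \<le> c * x" using c_pos by (simp add: field_simps)
    define k where "k = nat \<lceil>c * x\<rceil>"
    have k_ge: "c * x \<le> real k" unfolding k_def by linarith
    have k_le: "real k \<le> 2 * c * x" using cx unfolding k_def by linarith
    show "\<exists>A B. compl_biclique C n A B \<and> real (card A) \<ge> c * real n"
    proof (rule ccontr)
      assume "\<not> ?thesis"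
      then have small: "card A < k" if "compl_biclique C n A B" for A B
        using that k_ge unfolding x_def by fastforce
      have k0: "0 < k" using k_ge cx by simp
      have "real (2 * k) < real n"
      proof -
        have "4 * c * x < 1 * x" using c3 x2 by (intro mult_strict_right_mono) auto
        then show ?thesis using k_le by (simp add: x_def)
      qed
      then have kn: "2 * k < n" by simp
      have bound: "real (m * (m - 1)) * (x * (x - 1) - 2 * real (card (ig_edges C n)) - 4 * real k * x)
          \<le> 3/4 * M^2 * x^2 + 4 * M^6 * real k * x"
        unfolding x_def M_def
        by (rule few_disjoint_pairs_without_biclique[OF _ _ k0 kn small]) (use C in auto)
      have edges: "2 * real (card (ig_edges C n)) \<le> (1/4 - \<epsilon>) * (x * (x - 1))"
      proof -
        have ch: "2 * real (n choose 2) = x * (x - 1)"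
          using n by (simp add: choose_two x_def real_of_nat_div of_nat_diff)
        have "2 * real (card (ig_edges C n)) \<le> 2 * ((1/4 - \<epsilon>) * real (n choose 2))"
          using C by simp
        also have "\<dots> = (1/4 - \<epsilon>) * (2 * real (n choose 2))" by simp
        finally show ?thesis unfolding ch .
      qed
      have "(3/4 + \<epsilon>/2) * x^2 \<le> x * (x - 1) - 2 * real (card (ig_edges C n)) - 4 * real k * x"
      proof -
        have "4 * real k * x \<le> 8 * (c * x^2)"
          using mult_right_mono[OF k_le, of "4 * x"] x2 by (simp add: power2_eq_square)
        moreover have "(3/4 + \<epsilon>) * x \<le> (3/4 + \<epsilon>) * (c * x^2)"
          using mult_right_mono[OF cx, of x] x2 assms
          by (intro mult_left_mono) (auto simp: power2_eq_square mult_ac)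
        then have "3/4 * x + \<epsilon> * x \<le> 3/4 * (c * x^2) + \<epsilon> * (c * x^2)"
          by (simp only: distrib_right)
        \<comment> \<open>35/4 is 8 from the term with \<open>k\<close> plus 3/4 from the linear
          terms, which \<open>1 \<le> c * x\<close> turned into quadratic ones.\<close>
        moreover have "(35/4 * c + \<epsilon> * c) * x^2 \<le> (1/2 * \<epsilon>) * x^2"
        proof (rule mult_right_mono)
          have "0 < \<epsilon> * c" using assms c_pos by simp
          moreover have "64 * c + 64 * (\<epsilon> * c) \<le> \<epsilon>" using c1 by (simp add: algebra_simps)
          ultimately show "35/4 * c + \<epsilon> * c \<le> 1/2 * \<epsilon>" using c_pos by linarith
        qed simp
        then have "35/4 * (c * x^2) + \<epsilon> * (c * x^2) \<le> 1/2 * (\<epsilon> * x^2)"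
          by (simp only: distrib_right mult.assoc)
        moreover have "2 * real (card (ig_edges C n)) \<le> 1/4 * x^2 - 1/4 * x - \<epsilon> * x^2 + \<epsilon> * x"
          using edges by (simp add: algebra_simps power2_eq_square diff_divide_distrib)
        ultimately have "3/4 * x^2 + 1/2 * (\<epsilon> * x^2)
            \<le> x^2 - x - 2 * real (card (ig_edges C n)) - 4 * real k * x"
          by linarith
        then show ?thesis by (simp add: algebra_simps power2_eq_square)
      qed
      then have "real (m * (m - 1)) * ((3/4 + \<epsilon>/2) * x^2)
          \<le> real (m * (m - 1)) * (x * (x - 1) - 2 * real (card (ig_edges C n)) - 4 * real k * x)"
        by (intro mult_left_mono) auto
      also note bound
      also have "3/4 * M^2 * x^2 + 4 * M^6 * real k * x \<le> 3/4 * M^2 * x^2 + 4 * M^6 * (2 * c * x) * x"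
        using k_le x2 M2 by (intro add_left_mono mult_right_mono mult_left_mono) auto
      also have "real (m * (m - 1)) = M * (M - 1)"
        using M2 by (simp add: M_def of_nat_diff)
      finally have "x^2 * (M * ((M - 1) * (3/4 + \<epsilon>/2))) \<le> x^2 * (M * (3/4 * M + 8 * (M * (M^4 * c))))"
        by (simp add: algebra_simps power_numeral_reduce)
      then have "(M - 1) * (3/4 + \<epsilon>/2) \<le> 3/4 * M + 8 * (M * (M^4 * c))"
        using x2 M2 by (simp add: mult_le_cancel_left)
      moreover have "8 * (M * (M^4 * c)) \<le> M * \<epsilon> / 8"
        using mult_left_mono[OF c2, of M] M2 by simp
      moreover have "(M - 1) * (3/4 + \<epsilon>/2) = 3/4 * M + \<epsilon> * M / 2 - 3/4 - \<epsilon>/2"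
        by (simp add: field_simps)
      moreover have "M * \<epsilon> = \<epsilon> * M" by simp
      \<comment> \<open>What remains is
        \<open>3/8 * \<epsilon> * M \<le> 3/4 + \<epsilon>/2\<close>, which \<open>Me\<close>
        refutes.\<close>
      ultimately show False using Me assms by linarith
    qed
  qed
qed

theorem theorem4:
  fixes \<epsilon> :: real
  assumes "\<epsilon> > 0"
  shows "\<exists>c1 c2 :: real. \<exists>n0 :: nat. c1 > 0 \<and> c2 > 0 \<and> (\<forall>n\<ge>n0.
     (\<exists>C :: nat \<Rightarrow> (real \<times> real) set.
        (\<forall>i<n. is_curve (C i) \<and> x_monotone (C i)) \<and>
        real (card (ig_edges C n)) \<le> (1/4 + \<epsilon>) * real (n choose 2) \<and>
        \<not> (\<exists>A B. compl_biclique C n A B \<and> real (card A) \<ge> c1 * ln (real n)))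
   \<and>
     (\<forall>C :: nat \<Rightarrow> (real \<times> real) set.
        (\<forall>i<n. is_curve (C i) \<and> x_monotone (C i)) \<and>
        real (card (ig_edges C n)) \<le> (1/4 - \<epsilon>) * real (n choose 2) \<longrightarrow>
        (\<exists>A B. compl_biclique C n A B \<and> real (card A) \<ge> c2 * real n)))"
proof -
  obtain c1 where "c1 > 0" and sparse: "\<forall>n\<ge>2. \<exists>C :: nat \<Rightarrow> (real \<times> real) set.
        (\<forall>i<n. is_curve (C i) \<and> x_monotone (C i)) \<and>
        real (card (ig_edges C n)) \<le> (1/4 + \<epsilon>) * real (n choose 2) \<and>
        \<not> (\<exists>A B. compl_biclique C n A B \<and> real (card A) \<ge> c1 * ln (real n))"
    using sparse_curves_without_log_biclique[OF assms] by (elim exE conjE)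
  obtain c2 n0 where "c2 > 0" and linear: "\<forall>n\<ge>n0. \<forall>C :: nat \<Rightarrow> (real \<times> real) set.
        (\<forall>i<n. is_curve (C i) \<and> x_monotone (C i)) \<and>
        real (card (ig_edges C n)) \<le> (1/4 - \<epsilon>) * real (n choose 2) \<longrightarrow>
        (\<exists>A B. compl_biclique C n A B \<and> real (card A) \<ge> c2 * real n)"
    using sparse_curves_have_linear_biclique[OF assms] by (elim exE conjE)
  show ?thesis
  proof (rule exI[of _ c1], rule exI[of _ c2], rule exI[of _ "max 2 n0"],
      intro conjI[OF \<open>c1 > 0\<close> conjI[OF \<open>c2 > 0\<close>]], rule allI, rule impI)
    fix n assume "max 2 n0 \<le> n"
    then have "2 \<le> n" "n0 \<le> n" by simp_all
    show "(\<exists>C :: nat \<Rightarrow> (real \<times> real) set.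
        (\<forall>i<n. is_curve (C i) \<and> x_monotone (C i)) \<and>
        real (card (ig_edges C n)) \<le> (1/4 + \<epsilon>) * real (n choose 2) \<and>
        \<not> (\<exists>A B. compl_biclique C n A B \<and> real (card A) \<ge> c1 * ln (real n)))
      \<and> (\<forall>C :: nat \<Rightarrow> (real \<times> real) set.
        (\<forall>i<n. is_curve (C i) \<and> x_monotone (C i)) \<and>
        real (card (ig_edges C n)) \<le> (1/4 - \<epsilon>) * real (n choose 2) \<longrightarrow>
        (\<exists>A B. compl_biclique C n A B \<and> real (card A) \<ge> c2 * real n))"
      by (rule conjI[OF sparse[THEN spec, THEN mp, OF \<open>2 \<le> n\<close>] linear[THEN spec, THEN mp, OF \<open>n0 \<le> n\<close>]])
  qed
qed

end
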